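(* Let $\omega:\mathbb{N}\to[1,\infty)$ be a function such that $\lim_{n\to\infty}\omega(n)=\infty$, and let $\ell^1(\mathbb{N}_\wedge,\omega)$ be the associated dual Banach algebra with predual $c_0(\omega^{-1})$. Then: (i) $\ell^1(\mathbb{N}_\wedge,\omega)$ is not Connes amenable; (ii) $\ell^1(\mathbb{N}_\wedge,\omega)$ is not pointwise Connes amenable; (iii) $\ell^1(\mathbb{N}_\wedge,\omega)$ is pointwise $w^*$-approximately Connes amenable.
   Context: $\mathbb{N}_\wedge$ is the set $\mathbb{N}$ with the semigroup operation $m\wedge n:=\min\{m,n\}$. For a function $\omega:\mathbb{N}\to[1,\infty)$ (automatically a weight on $\mathbb{N}_\wedge$, i.e. $\omega(m\wedge n)\le\omega(m)\omega(n)$), $\ell^1(\mathbb{N}_\wedge,\omega)$ is the Banach space of complex sequences $(a_n)$ with $\|(a_n)\|=\sum_n|a_n|\omega(n)<\infty$, a commutative Banach algebra with the convolution product determined by $\delta_m\star\delta_n=\delta_{m\wedge n}$, where $\delta_n$ is the characteristic function of $\{n\}$. When $\lim_n\omega(n)=\infty$ it is a dual Banach algebra with predual $c_0(\omega^{-1})$, the Banach space of complex sequences $(b_n)$ with $b_n/\omega(n)\to0$, normed by $\sup_n|b_n|/\omega(n)$, and duality $\langle b,a\rangle=\sum_na_nb_n$. Let $\mathcal{A}$ be a Banach algebra. A Banach $\mathcal{A}$-bimodule $E$ is dual if there is a closed submodule $E_*$ of $E^*$ (the predual) such that $E=(E_* )^*$. A Banach algebra is a dual Banach algebra if it is dual as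 a Banach bimodule over itself. For a dual Banach algebra $\mathcal{A}$, a dual Banach $\mathcal{A}$-bimodule $E$ is normal if the module actions of $\mathcal{A}$ on $E$ are $w^*$-continuous, i.e. for each $x\in E$ the maps $a\mapsto a\cdot x$ and $a\mapsto x\cdot a$ from $\mathcal{A}$ to $E$ are $w^*$-$w^*$-continuous. A derivation is a bounded linear map $D:\mathcal{A}\to E$ with $D(ab)=D(a)\cdot b+a\cdot D(b)$; it is $w^*$-continuous if it is $w^*$-$w^*$-continuous. A dual Banach algebra $\mathcal{A}$ is: - Connes amenable if for every normal, dual Banach $\mathcal{A}$-bimodule $E$ and every $w^*$-continuous derivation $D:\mathcal{A}\to E$ there is $x\in E$ with $D(a)=a\cdot x-x\cdot a$ for all $a\in\mathcal{A}$; - pointwise Connes amenable if for each $a_0\in\mathcal{A}$ and all such $E$, $D$ there is $x\in E$ with $D(a_0)=a_0\cdot x-x\cdot a_0$; - pointwise $w^*$-approximately Connes amenable if for each $a_0\in\mathcal{A}$ and all such $E$, $D$ there is a net $(x_n)\subseteq E$ with $D(a_0)=w^*\text{-}\lim_n(a_0\cdot x_n-x_n\cdot a_0)$. *)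

theory Defs
  imports "HOL-Analysis.Analysis" "HOL-Library.Function_Algebras"
begin

section \<open>Complex Banach spaces and their duals\<close>

text \<open>
  The algebra of interest depends on a weight, so Banach spaces cannot be types here.  A complex
  normed space is a linear subspace \<open>vecs\<close> of an ambient abelian group type which carries a complex
  vector space structure \<open>scl\<close>; addition is the one of the type.
\<close>

record 'v nspace =
  vecs :: "'v set"
  scl :: "complex \<Rightarrow> 'v \<Rightarrow> 'v"
  nrm :: "'v \<Rightarrow> real"

definition normed_space :: "('v::ab_group_add, 'z) nspace_scheme \<Rightarrow> bool" where
  "normed_space E \<longleftrightarrow>
     vector_space (scl E) \<and> module.subspace (scl E) (vecs E) \<and>
     (\<forall>x\<in>vecs E. 0 \<le> nrm E x \<and> (nrm E x = 0 \<longleftrightarrow> x = 0)) \<and>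
     (\<forall>x\<in>vecs E. \<forall>y\<in>vecs E. nrm E (x + y) \<le> nrm E x + nrm E y) \<and>
     (\<forall>c. \<forall>x\<in>vecs E. nrm E (scl E c x) = cmod c * nrm E x)"

text \<open>
  The locale \<open>Metric_space\<close> wants a distance that is nonnegative and symmetric on the whole type, hence
  the value 0 outside the carrier.
\<close>

definition ndist :: "('v::ab_group_add, 'z) nspace_scheme \<Rightarrow> 'v \<Rightarrow> 'v \<Rightarrow> real" where
  "ndist E x y = (if x \<in> vecs E \<and> y \<in> vecs E then nrm E (x - y) else 0)"

definition banach_space :: "('v::ab_group_add, 'z) nspace_scheme \<Rightarrow> bool" where
  "banach_space E \<longleftrightarrow> normed_space E \<and> Metric_space.mcomplete (vecs E) (ndist E)"

definition linear_map ::
    "('v::ab_group_add, 'y) nspace_scheme \<Rightarrow> ('w::ab_group_add, 'z) nspace_scheme \<Rightarrow> ('v \<Rightarrow> 'w) \<Rightarrow> bool"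
  where
  "linear_map E F f \<longleftrightarrow>
     f ` vecs E \<subseteq> vecs F \<and>
     (\<forall>x\<in>vecs E. \<forall>y\<in>vecs E. f (x + y) = f x + f y) \<and>
     (\<forall>c. \<forall>x\<in>vecs E. f (scl E c x) = scl F c (f x))"

definition bounded_linear_map ::
    "('v::ab_group_add, 'y) nspace_scheme \<Rightarrow> ('w::ab_group_add, 'z) nspace_scheme \<Rightarrow> ('v \<Rightarrow> 'w) \<Rightarrow> bool"
  where
  "bounded_linear_map E F f \<longleftrightarrow>
     linear_map E F f \<and> (\<exists>K. \<forall>x\<in>vecs E. nrm F (f x) \<le> K * nrm E x)"

definition complex_space :: "complex nspace" where
  "complex_space = \<lparr>vecs = UNIV, scl = (*), nrm = cmod\<rparr>"

text \<open>
  The functional that agrees with \<open>f\<close> on the carrier.  Functionals are normalised to vanish outside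
  the carrier, so that equality and pointwise addition of functionals are those of the function type.
\<close>

definition on_vecs :: "('v, 'z) nspace_scheme \<Rightarrow> ('v \<Rightarrow> complex) \<Rightarrow> 'v \<Rightarrow> complex" where
  "on_vecs E f = (\<lambda>x. if x \<in> vecs E then f x else 0)"

definition dual_space :: "('v::ab_group_add, 'z) nspace_scheme \<Rightarrow> ('v \<Rightarrow> complex) nspace" where
  "dual_space E =
     \<lparr>vecs = {f. bounded_linear_map E complex_space f \<and> on_vecs E f = f},
      scl = (\<lambda>c f x. c * f x),
      nrm = (\<lambda>f. SUP x\<in>{x \<in> vecs E. nrm E x \<le> 1}. cmod (f x))\<rparr>"

text \<open>The \<open>w\<^sup>*\<close>-topology on \<open>E\<close> given by a predual \<open>P\<close>, regarded as a set of functionals on \<open>E\<close>.\<close>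

definition wstar :: "('v, 'z) nspace_scheme \<Rightarrow> ('v \<Rightarrow> complex) set \<Rightarrow> 'v topology" where
  "wstar E P = topology_generated_by {{x \<in> vecs E. f x \<in> U} |f U. f \<in> P \<and> open U}"


section \<open>Banach algebras and dual modules\<close>

record 'a nalgebra = "'a nspace" +
  mul :: "'a \<Rightarrow> 'a \<Rightarrow> 'a"

definition banach_algebra :: "('a::ab_group_add, 'z) nalgebra_scheme \<Rightarrow> bool" where
  "banach_algebra A \<longleftrightarrow>
     banach_space A \<and>
     (\<forall>a\<in>vecs A. linear_map A A (mul A a)) \<and>
     (\<forall>b\<in>vecs A. linear_map A A (\<lambda>a. mul A a b)) \<and>
     (\<forall>a\<in>vecs A. \<forall>b\<in>vecs A. \<forall>c\<in>vecs A. mul A (mul A a b) c = mul A a (mul A b c)) \<and>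
     (\<forall>a\<in>vecs A. \<forall>b\<in>vecs A. nrm A (mul A a b) \<le> nrm A a * nrm A b)"

text \<open>In a bimodule, \<open>lact E a x\<close> is \<open>a \<cdot> x\<close> and \<open>ract E x a\<close> is \<open>x \<cdot> a\<close>.\<close>

record ('a, 'e) bimodule = "'e nspace" +
  lact :: "'a \<Rightarrow> 'e \<Rightarrow> 'e"
  ract :: "'e \<Rightarrow> 'a \<Rightarrow> 'e"

definition banach_bimodule ::
    "('a::ab_group_add, 'z) nalgebra_scheme \<Rightarrow> ('a, 'e::ab_group_add) bimodule \<Rightarrow> bool" where
  "banach_bimodule A E \<longleftrightarrow>
     banach_space E \<and>
     (\<forall>a\<in>vecs A. linear_map E E (lact E a) \<and> linear_map E E (\<lambda>x. ract E x a)) \<and>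
     (\<forall>x\<in>vecs E. linear_map A E (\<lambda>a. lact E a x) \<and> linear_map A E (ract E x)) \<and>
     (\<forall>a\<in>vecs A. \<forall>b\<in>vecs A. \<forall>x\<in>vecs E.
        lact E (mul A a b) x = lact E a (lact E b x) \<and>
        ract E x (mul A a b) = ract E (ract E x a) b \<and>
        ract E (lact E a x) b = lact E a (ract E x b)) \<and>
     (\<exists>K. \<forall>a\<in>vecs A. \<forall>x\<in>vecs E.
        nrm E (lact E a x) \<le> K * nrm A a * nrm E x \<and>
        nrm E (ract E x a) \<le> K * nrm A a * nrm E x)"

text \<open>
  \<open>P\<close> is a closed submodule of \<open>E\<^sup>*\<close>, where \<open>E\<^sup>*\<close> has the actions \<open>(a \<cdot> f) x = f (x \<cdot> a)\<close> and
  \<open>(f \<cdot> a) x = f (a \<cdot> x)\<close>, and \<open>E = P\<^sup>*\<close>: the canonical map from \<open>E\<close> to \<open>P\<^sup>*\<close> is an isometric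
  bijection.
\<close>

definition dual_bimodule ::
    "('a::ab_group_add, 'z) nalgebra_scheme \<Rightarrow> ('a, 'e::ab_group_add) bimodule \<Rightarrow> ('e \<Rightarrow> complex) set \<Rightarrow> bool"
  where
  "dual_bimodule A E P \<longleftrightarrow>
     banach_bimodule A E \<and>
     P \<subseteq> vecs (dual_space E) \<and>
     module.subspace (scl (dual_space E)) P \<and>
     closedin (Metric_space.mtopology (vecs (dual_space E)) (ndist (dual_space E))) P \<and>
     (\<forall>a\<in>vecs A. \<forall>f\<in>P. on_vecs E (\<lambda>x. f (ract E x a)) \<in> P \<and> on_vecs E (\<lambda>x. f (lact E a x)) \<in> P) \<and>
     (let P_space = (dual_space E)\<lparr>vecs := P\<rparr>;
          canonical = (\<lambda>x. on_vecs P_space (\<lambda>f. f x))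
      in bij_betw canonical (vecs E) (vecs (dual_space P_space)) \<and>
         (\<forall>x\<in>vecs E. nrm (dual_space P_space) (canonical x) = nrm E x))"

definition self_bimodule :: "'a nalgebra \<Rightarrow> ('a, 'a) bimodule" where
  "self_bimodule A = \<lparr>vecs = vecs A, scl = scl A, nrm = nrm A, lact = mul A, ract = mul A\<rparr>"

definition dual_banach_algebra :: "'a::ab_group_add nalgebra \<Rightarrow> ('a \<Rightarrow> complex) set \<Rightarrow> bool" where
  "dual_banach_algebra A P \<longleftrightarrow> banach_algebra A \<and> dual_bimodule A (self_bimodule A) P"

text \<open>From here on \<open>PA\<close> and \<open>PE\<close> are the preduals of the dual Banach algebra \<open>A\<close> and of \<open>E\<close>.\<close>

definition normal_dual_bimodule ::
    "'a::ab_group_add nalgebra \<Rightarrow> ('a \<Rightarrow> complex) set \<Rightarrow>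
     ('a, 'e::ab_group_add) bimodule \<Rightarrow> ('e \<Rightarrow> complex) set \<Rightarrow> bool" where
  "normal_dual_bimodule A PA E PE \<longleftrightarrow>
     dual_bimodule A E PE \<and>
     (\<forall>x\<in>vecs E. continuous_map (wstar A PA) (wstar E PE) (\<lambda>a. lact E a x) \<and>
                 continuous_map (wstar A PA) (wstar E PE) (\<lambda>a. ract E x a))"

definition derivation ::
    "'a::ab_group_add nalgebra \<Rightarrow> ('a, 'e::ab_group_add) bimodule \<Rightarrow> ('a \<Rightarrow> 'e) \<Rightarrow> bool" where
  "derivation A E D \<longleftrightarrow>
     bounded_linear_map A E D \<and>
     (\<forall>a\<in>vecs A. \<forall>b\<in>vecs A. D (mul A a b) = ract E (D a) b + lact E a (D b))"

definition wstar_derivation ::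
    "'a::ab_group_add nalgebra \<Rightarrow> ('a \<Rightarrow> complex) set \<Rightarrow>
     ('a, 'e::ab_group_add) bimodule \<Rightarrow> ('e \<Rightarrow> complex) set \<Rightarrow> ('a \<Rightarrow> 'e) \<Rightarrow> bool" where
  "wstar_derivation A PA E PE D \<longleftrightarrow>
     derivation A E D \<and> continuous_map (wstar A PA) (wstar E PE) D"


section \<open>Notions of Connes amenability\<close>

text \<open>
  HOL formulas cannot quantify over types.  The type argument of the following predicates is the
  ambient type of the modules \<open>E\<close> that are quantified over.  The notions proper range over all ambient
  types: such a property holds if it holds for an arbitrary type \<open>'e\<close>, and it fails if it fails for
  some \<open>'e\<close>.
\<close>

definition connes_amenable ::
    "'e::ab_group_add itself \<Rightarrow> 'a::ab_group_add nalgebra \<Rightarrow> ('a \<Rightarrow> complex) set \<Rightarrow> bool" where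
  "connes_amenable _ A PA \<longleftrightarrow>
     (\<forall>(E :: ('a, 'e) bimodule) PE D.
        normal_dual_bimodule A PA E PE \<and> wstar_derivation A PA E PE D \<longrightarrow>
        (\<exists>x\<in>vecs E. \<forall>a\<in>vecs A. D a = lact E a x - ract E x a))"

definition pointwise_connes_amenable ::
    "'e::ab_group_add itself \<Rightarrow> 'a::ab_group_add nalgebra \<Rightarrow> ('a \<Rightarrow> complex) set \<Rightarrow> bool" where
  "pointwise_connes_amenable _ A PA \<longleftrightarrow>
     (\<forall>a\<^sub>0\<in>vecs A. \<forall>(E :: ('a, 'e) bimodule) PE D.
        normal_dual_bimodule A PA E PE \<and> wstar_derivation A PA E PE D \<longrightarrow>
        (\<exists>x\<in>vecs E. D a\<^sub>0 = lact E a\<^sub>0 x - ract E x a\<^sub>0))"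

definition directed_set :: "'i set \<Rightarrow> ('i \<Rightarrow> 'i \<Rightarrow> bool) \<Rightarrow> bool" where
  "directed_set I le \<longleftrightarrow>
     I \<noteq> {} \<and> (\<forall>i\<in>I. le i i) \<and>
     (\<forall>i\<in>I. \<forall>j\<in>I. \<forall>k\<in>I. le i j \<and> le j k \<longrightarrow> le i k) \<and>
     (\<forall>i\<in>I. \<forall>j\<in>I. \<exists>k\<in>I. le i k \<and> le j k)"

definition net_filter :: "'i set \<Rightarrow> ('i \<Rightarrow> 'i \<Rightarrow> bool) \<Rightarrow> 'i filter" where
  "net_filter I le = (INF i\<in>I. principal {j \<in> I. le i j})"

text \<open>
  The index sets of the nets consist of subsets of \<open>'e\<close>.  This is no restriction: whenever some net of
  elements \<open>a\<^sub>0 \<cdot> x\<^sub>i - x\<^sub>i \<cdot> a\<^sub>0\<close> converges to a point, so does one indexed by the \<open>w\<^sup>*\<close>-open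
  neighbourhoods of that point.
\<close>

definition pointwise_wstar_approx_connes_amenable ::
    "'e::ab_group_add itself \<Rightarrow> 'a::ab_group_add nalgebra \<Rightarrow> ('a \<Rightarrow> complex) set \<Rightarrow> bool" where
  "pointwise_wstar_approx_connes_amenable _ A PA \<longleftrightarrow>
     (\<forall>a\<^sub>0\<in>vecs A. \<forall>(E :: ('a, 'e) bimodule) PE D.
        normal_dual_bimodule A PA E PE \<and> wstar_derivation A PA E PE D \<longrightarrow>
        (\<exists>(I :: 'e set set) le x.
           directed_set I le \<and> (\<forall>i\<in>I. x i \<in> vecs E) \<and>
           limitin (wstar E PE) (\<lambda>i. lact E a\<^sub>0 (x i) - ract E (x i) a\<^sub>0) (D a\<^sub>0) (net_filter I le)))"


section \<open>The algebra \<open>\<ell>\<^sup>1(\<nat>\<^sub>\<and>, \<omega>)\<close> and its predual \<open>c\<^sub>0(\<omega>\<^sup>-\<^sup>1)\<close>\<close>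

definition l1_min :: "(nat \<Rightarrow> real) \<Rightarrow> (nat \<Rightarrow> complex) nalgebra" where
  "l1_min \<omega> =
     \<lparr>vecs = {a. summable (\<lambda>n. cmod (a n) * \<omega> n)},
      scl = (\<lambda>c a n. c * a n),
      nrm = (\<lambda>a. \<Sum>n. cmod (a n) * \<omega> n),
      mul = (\<lambda>a b k. \<Sum>\<^sub>\<infinity>(m, n)\<in>{(m, n). min m n = k}. a m * b n)\<rparr>"

definition c0_inv :: "(nat \<Rightarrow> real) \<Rightarrow> (nat \<Rightarrow> complex) nspace" where
  "c0_inv \<omega> =
     \<lparr>vecs = {b. (\<lambda>n. b n / of_real (\<omega> n)) \<longlonglongrightarrow> 0},
      scl = (\<lambda>c b n. c * b n),
      nrm = (\<lambda>b. SUP n. cmod (b n) / \<omega> n)\<rparr>"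

definition c0_functional :: "(nat \<Rightarrow> real) \<Rightarrow> (nat \<Rightarrow> complex) \<Rightarrow> (nat \<Rightarrow> complex) \<Rightarrow> complex" where
  "c0_functional \<omega> b = on_vecs (l1_min \<omega>) (\<lambda>a. \<Sum>n. a n * b n)"

definition c0_predual :: "(nat \<Rightarrow> real) \<Rightarrow> ((nat \<Rightarrow> complex) \<Rightarrow> complex) set" where
  "c0_predual \<omega> = c0_functional \<omega> ` vecs (c0_inv \<omega>)"


section \<open>\<open>\<ell>\<^sup>1(\<nat>\<^sub>\<and>, \<omega>)\<close> is a dual Banach algebra\<close>

lemma vector_space_fun: "vector_space (\<lambda>c (f::'a \<Rightarrow> complex) n. c * f n)"
  by unfold_locales (auto simp: fun_eq_iff algebra_simps)

lemmas subspace_fun_def =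
  module.subspace_def[OF vector_space_fun[unfolded module_iff_vector_space[symmetric]]]

lemma normed_space_zero: "normed_space E \<Longrightarrow> 0 \<in> vecs E"
  unfolding normed_space_def
  by (metis module.subspace_0 module_iff_vector_space)

lemma normed_space_scl:
  assumes "normed_space E" "x \<in> vecs E" shows "scl E c x \<in> vecs E"
  using assms unfolding normed_space_def by (metis module.subspace_scale module_iff_vector_space)

lemma normed_space_add:
  assumes "normed_space E" "x \<in> vecs E" "y \<in> vecs E" shows "x + y \<in> vecs E"
  using assms unfolding normed_space_def by (metis module.subspace_add module_iff_vector_space)

lemma normed_space_diff:
  assumes "normed_space E" "x \<in> vecs E" "y \<in> vecs E" shows "x - y \<in> vecs E"
  using assms unfolding normed_space_def by (metis module.subspace_diff module_iff_vector_space)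

lemma normed_space_triangle:
  assumes "normed_space E" "x \<in> vecs E" "y \<in> vecs E" shows "nrm E (x + y) \<le> nrm E x + nrm E y"
  using assms unfolding normed_space_def by simp

lemma normed_space_minus:
  assumes "normed_space E" "x \<in> vecs E" shows "scl E (-1) x = - x"
  using assms unfolding normed_space_def
  by (metis module.scale_minus_left module.scale_one module_iff_vector_space)

lemma Metric_space_ndist:
  assumes E: "normed_space E"
  shows "Metric_space (vecs E) (ndist E)"
proof
  have sym: "nrm E (x - y) = nrm E (y - x)" if "x \<in> vecs E" "y \<in> vecs E" for x y
  proof -
    have m: "y - x \<in> vecs E" using normed_space_diff E that by blast
    then have "nrm E (scl E (-1) (y - x)) = nrm E (y - x)"
      using E unfolding normed_space_def by force
    with normed_space_minus[OF E m] show ?thesis by simp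
  qed
  show "0 \<le> ndist E x y" for x y
    using E normed_space_diff[OF E] unfolding ndist_def normed_space_def by auto
  show "ndist E x y = ndist E y x" for x y
    using sym unfolding ndist_def by auto
  show "ndist E x y = 0 \<longleftrightarrow> x = y" if "x \<in> vecs E" "y \<in> vecs E" for x y
    using E normed_space_diff[OF E that] that unfolding ndist_def normed_space_def by auto
  show "ndist E x z \<le> ndist E x y + ndist E y z" if "x \<in> vecs E" "y \<in> vecs E" "z \<in> vecs E" for x y z
  proof -
    have "nrm E ((x - y) + (y - z)) \<le> nrm E (x - y) + nrm E (y - z)"
      using normed_space_triangle[OF E] normed_space_diff[OF E] that by metis
    then show ?thesis using that by (simp add: ndist_def)
  qed
qed

lemma dual_space_bound:
  assumes E: "normed_space E" and f: "f \<in> vecs (dual_space E)" and x: "x \<in> vecs E"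
  shows "cmod (f x) \<le> nrm (dual_space E) f * nrm E x"
proof -
  have "\<exists>K. \<forall>x\<in>vecs E. cmod (f x) \<le> K * nrm E x"
    and lin: "\<And>c x. x \<in> vecs E \<Longrightarrow> f (scl E c x) = c * f x"
    using f by (auto simp: dual_space_def bounded_linear_map_def linear_map_def complex_space_def)
  then obtain K where K: "\<And>x. x \<in> vecs E \<Longrightarrow> cmod (f x) \<le> K * nrm E x" by blast
  have bdd: "bdd_above ((\<lambda>x. cmod (f x)) ` {x \<in> vecs E. nrm E x \<le> 1})"
  proof (rule bdd_aboveI2)
    fix y assume "y \<in> {x \<in> vecs E. nrm E x \<le> 1}"
    then have y: "y \<in> vecs E" "nrm E y \<le> 1" "0 \<le> nrm E y" using E by (auto simp: normed_space_def)
    show "cmod (f y) \<le> max K 0" using K[OF y(1)] y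
      by (smt (verit) mult_left_le mult_nonneg_nonneg mult_nonpos_nonneg)
  qed
  show ?thesis
  proof (cases "nrm E x = 0")
    case True
    with K[OF x] show ?thesis by simp
  next
    case False
    then have pos: "nrm E x > 0" using E x by (force simp: normed_space_def)
    define y where "y = scl E (complex_of_real (1 / nrm E x)) x"
    have y: "y \<in> vecs E" unfolding y_def using normed_space_scl E x by blast
    have "nrm E y = 1" proof -
      have "nrm E y = cmod (complex_of_real (1 / nrm E x)) * nrm E x"
        using E x unfolding y_def normed_space_def by blast
      then show ?thesis using pos by (simp add: norm_divide)
    qed
    then have "cmod (f y) \<le> nrm (dual_space E) f"
      unfolding dual_space_def using bdd y by (auto intro!: cSUP_upper)
    moreover have "cmod (f y) = cmod (f x) / nrm E x"
      unfolding y_def using lin[OF x] pos by (simp add: norm_mult norm_divide)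
    ultimately show ?thesis using pos by (simp add: divide_simps)
  qed
qed

lemma dual_space_leI:
  assumes E: "normed_space E" and "\<And>x. x \<in> vecs E \<Longrightarrow> cmod (f x) \<le> K * nrm E x" "0 \<le> K"
  shows "nrm (dual_space E) f \<le> K"
proof -
  have "0 \<in> {x \<in> vecs E. nrm E x \<le> 1}" using E normed_space_zero[OF E] by (force simp: normed_space_def)
  moreover have "cmod (f x) \<le> K" if "x \<in> {x \<in> vecs E. nrm E x \<le> 1}" for x
    using assms(2)[of x] that assms(3) by (smt (verit) mem_Collect_eq mult_left_le)
  ultimately show ?thesis unfolding dual_space_def by (auto intro!: cSUP_least)
qed

lemma mem_dual_space:
  "f \<in> vecs (dual_space E) \<longleftrightarrow>
    (\<forall>x\<in>vecs E. \<forall>y\<in>vecs E. f (x + y) = f x + f y) \<and> (\<forall>c. \<forall>x\<in>vecs E. f (scl E c x) = c * f x) \<and>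
    (\<exists>K. \<forall>x\<in>vecs E. cmod (f x) \<le> K * nrm E x) \<and> (\<forall>x. x \<notin> vecs E \<longrightarrow> f x = 0)"
  by (auto simp: dual_space_def bounded_linear_map_def linear_map_def complex_space_def on_vecs_def fun_eq_iff)

lemma dual_space_normed:
  assumes E: "normed_space E"
  shows "normed_space (dual_space E)"
proof -
  have s: "scl (dual_space E) = (\<lambda>c f x. c * f x)" by (simp add: dual_space_def)
  have sub: "module.subspace (\<lambda>c f x. c * f x) (vecs (dual_space E))"
    unfolding subspace_fun_def
  proof (intro conjI ballI allI)
    show "0 \<in> vecs (dual_space E)" using E by (auto simp: mem_dual_space normed_space_def intro!: exI[of _ 0])
    fix f g :: "'a \<Rightarrow> complex" and c assume f: "f \<in> vecs (dual_space E)"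
    show "(\<lambda>x. c * f x) \<in> vecs (dual_space E)"
    proof -
      obtain K where K: "\<forall>x\<in>vecs E. cmod (f x) \<le> K * nrm E x" using f by (auto simp: mem_dual_space)
      have "\<forall>x\<in>vecs E. cmod (c * f x) \<le> (cmod c * K) * nrm E x"
        using K by (auto simp: norm_mult mult.assoc intro!: mult_left_mono)
      then have "\<exists>K. \<forall>x\<in>vecs E. cmod (c * f x) \<le> K * nrm E x" by blast
      then show ?thesis using f unfolding mem_dual_space by (auto simp: algebra_simps)
    qed
    assume g: "g \<in> vecs (dual_space E)"
    show "f + g \<in> vecs (dual_space E)"
    proof -
      obtain K L where "\<forall>x\<in>vecs E. cmod (f x) \<le> K * nrm E x" "\<forall>x\<in>vecs E. cmod (g x) \<le> L * nrm E x"
        using f g by (auto simp: mem_dual_space)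
      then have "\<forall>x\<in>vecs E. cmod ((f + g) x) \<le> (K + L) * nrm E x"
        by (auto simp: algebra_simps intro!: norm_triangle_le add_mono)
      then have "\<exists>K. \<forall>x\<in>vecs E. cmod ((f + g) x) \<le> K * nrm E x" by blast
      then show ?thesis using f g unfolding mem_dual_space by (auto simp: algebra_simps)
    qed
  qed
  have nonneg: "0 \<le> nrm (dual_space E) f" if f: "f \<in> vecs (dual_space E)" for f
  proof (cases "\<exists>x\<in>vecs E. nrm E x \<noteq> 0")
    case True
    then obtain x where x: "x \<in> vecs E" "nrm E x > 0" using E by (force simp: normed_space_def)
    with dual_space_bound[OF E f x(1)] show ?thesis
      by (smt (verit) mult_neg_pos norm_ge_zero)
  next
    case False
    then have *: "{x \<in> vecs E. nrm E x \<le> 1} = {0}" using E normed_space_zero[OF E] by (auto simp: normed_space_def)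
    show ?thesis unfolding dual_space_def nspace.simps * by simp
  qed
  have hom: "nrm (dual_space E) (\<lambda>x. c * f x) \<le> cmod c * nrm (dual_space E) f"
    if f: "f \<in> vecs (dual_space E)" for f c
    by (rule dual_space_leI[OF E])
       (use dual_space_bound[OF E f] nonneg[OF f] in
         \<open>auto simp: norm_mult mult.assoc intro!: mult_left_mono\<close>)
  have sf: "(\<lambda>x. c * f x) \<in> vecs (dual_space E)" if "f \<in> vecs (dual_space E)" for f c
    using sub that unfolding subspace_fun_def by blast
  show ?thesis
    unfolding normed_space_def s
  proof (intro conjI ballI allI vector_space_fun sub)
    fix f g :: "'a \<Rightarrow> complex" and c assume f: "f \<in> vecs (dual_space E)"
    show "0 \<le> nrm (dual_space E) f" by (rule nonneg[OF f])
    show "nrm (dual_space E) f = 0 \<longleftrightarrow> f = 0"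
    proof
      assume "nrm (dual_space E) f = 0"
      then have "f x = 0" for x
        using dual_space_bound[OF E f, of x] f by (cases "x \<in> vecs E") (auto simp: mem_dual_space)
      then show "f = 0" by (simp add: fun_eq_iff)
    next
      assume "f = 0"
      then have "nrm (dual_space E) f \<le> 0" by (intro dual_space_leI[OF E]) auto
      with nonneg[OF f] show "nrm (dual_space E) f = 0" by simp
    qed
    show "nrm (dual_space E) (\<lambda>x. c * f x) = cmod c * nrm (dual_space E) f"
    proof (cases "c = 0")
      case True
      then show ?thesis using hom[OF f, of 0] nonneg[OF sf[OF f, of 0]] by simp
    next
      case False
      have "(\<lambda>x. inverse c * (c * f x)) = f" using False by (simp add: fun_eq_iff)
      then have "nrm (dual_space E) f \<le> cmod (inverse c) * nrm (dual_space E) (\<lambda>x. c * f x)"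
        using hom[OF sf[OF f], of "inverse c" c] by simp
      then have "cmod c * nrm (dual_space E) f \<le> nrm (dual_space E) (\<lambda>x. c * f x)"
        using False by (simp add: norm_inverse norm_divide field_simps)
      with hom[OF f, of c] show ?thesis by simp
    qed
    assume g: "g \<in> vecs (dual_space E)"
    show "nrm (dual_space E) (f + g) \<le> nrm (dual_space E) f + nrm (dual_space E) g"
      by (rule dual_space_leI[OF E])
         (use dual_space_bound[OF E f] dual_space_bound[OF E g] nonneg[OF f] nonneg[OF g] in
           \<open>auto simp: algebra_simps intro!: norm_triangle_le add_mono\<close>)
  qed
qed

lemma l1_min_simps [simp]:
  "vecs (l1_min \<omega>) = {a. summable (\<lambda>n. cmod (a n) * \<omega> n)}"
  "scl (l1_min \<omega>) = (\<lambda>c a n. c * a n)"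
  "nrm (l1_min \<omega>) = (\<lambda>a. \<Sum>n. cmod (a n) * \<omega> n)"
  by (simp_all add: l1_min_def)

locale l1_weight =
  fixes \<omega> :: "nat \<Rightarrow> real"
  assumes w1: "\<And>n. 1 \<le> \<omega> n"
begin

lemma w0: "0 < \<omega> n" "0 \<le> \<omega> n" "\<omega> n \<noteq> 0"
  using w1[of n] by linarith+

lemma l1_normed: "normed_space (l1_min \<omega>)"
proof -
  have add: "summable (\<lambda>n. cmod (a n + b n) * \<omega> n)"
    "(\<Sum>n. cmod (a n + b n) * \<omega> n) \<le> (\<Sum>n. cmod (a n) * \<omega> n) + (\<Sum>n. cmod (b n) * \<omega> n)"
    if "summable (\<lambda>n. cmod (a n) * \<omega> n)" "summable (\<lambda>n. cmod (b n) * \<omega> n)" for a b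
  proof -
    have le: "cmod (a n + b n) * \<omega> n \<le> cmod (a n) * \<omega> n + cmod (b n) * \<omega> n" for n
      using w0 by (simp add: distrib_right[symmetric] mult_right_mono norm_triangle_ineq)
    show s: "summable (\<lambda>n. cmod (a n + b n) * \<omega> n)"
      by (rule summable_comparison_test'[OF summable_add[OF that]]) (use w0 le in \<open>auto simp: abs_mult\<close>)
    show "(\<Sum>n. cmod (a n + b n) * \<omega> n) \<le> (\<Sum>n. cmod (a n) * \<omega> n) + (\<Sum>n. cmod (b n) * \<omega> n)"
      unfolding suminf_add[OF that] by (rule suminf_le[OF le s summable_add[OF that]])
  qed
  have z: "(\<Sum>n. cmod (a n) * \<omega> n) = 0 \<longleftrightarrow> a = 0" if "summable (\<lambda>n. cmod (a n) * \<omega> n)" for a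
    using suminf_eq_zero_iff[OF that] w0 by (auto simp: fun_eq_iff)
  show ?thesis
    unfolding normed_space_def l1_min_simps subspace_fun_def
    by (intro conjI ballI allI vector_space_fun)
      (use add z w0 in \<open>auto simp: norm_mult mult.assoc suminf_mult intro!: suminf_nonneg summable_mult\<close>)
qed

lemma l1_banach: "banach_space (l1_min \<omega>)"
proof -
  interpret Metric_space "vecs (l1_min \<omega>)" "ndist (l1_min \<omega>)"
    by (rule Metric_space_ndist[OF l1_normed])
  have "\<exists>a. limitin mtopology \<sigma> a sequentially" if C: "MCauchy \<sigma>" for \<sigma>
  proof -
    have S: "\<sigma> n \<in> vecs (l1_min \<omega>)" for n using C unfolding MCauchy_def by blast
    have D: "summable (\<lambda>k. cmod (\<sigma> n k - \<sigma> m k) * \<omega> k)" for n m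
      using normed_space_diff[OF l1_normed S S, of n m] by (simp)
    have dist: "ndist (l1_min \<omega>) (\<sigma> n) (\<sigma> m) = (\<Sum>k. cmod (\<sigma> n k - \<sigma> m k) * \<omega> k)" for n m
      using S by (simp add: ndist_def)
    have ev: "\<exists>N. \<forall>n\<ge>N. \<forall>m\<ge>N. (\<Sum>k. cmod (\<sigma> n k - \<sigma> m k) * \<omega> k) < e" if "e > 0" for e
    proof -
      have "\<exists>N. \<forall>n m. N \<le> n \<longrightarrow> N \<le> m \<longrightarrow> ndist (l1_min \<omega>) (\<sigma> n) (\<sigma> m) < e"
        using C that unfolding MCauchy_def by metis
      then show ?thesis unfolding dist by metis
    qed
    have "Cauchy (\<lambda>n. \<sigma> n k)" for k
    proof (rule metric_CauchyI)
      fix e :: real assume "e > 0"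
      then obtain N where N: "\<And>n m. n \<ge> N \<Longrightarrow> m \<ge> N \<Longrightarrow> (\<Sum>k. cmod (\<sigma> n k - \<sigma> m k) * \<omega> k) < e"
        using ev by blast
      have "dist (\<sigma> n k) (\<sigma> m k) < e" if nm: "n \<ge> N" "m \<ge> N" for n m
      proof -
        have "cmod (\<sigma> n k - \<sigma> m k) * 1 \<le> cmod (\<sigma> n k - \<sigma> m k) * \<omega> k"
          by (intro mult_left_mono w1) auto
        also have "\<dots> \<le> (\<Sum>k. cmod (\<sigma> n k - \<sigma> m k) * \<omega> k)"
          using sum_le_suminf[OF D, of "{k}" n m] w0 by auto
        finally show ?thesis using N[OF nm] by (simp add: dist_norm)
      qed
      then show "\<exists>M. \<forall>m\<ge>M. \<forall>n\<ge>M. dist (\<sigma> m k) (\<sigma> n k) < e" by blast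
    qed
    then have "\<forall>k. \<exists>l. (\<lambda>n. \<sigma> n k) \<longlonglongrightarrow> l" by (simp add: Cauchy_convergent convergent_def[symmetric])
    then obtain a where a: "\<And>k. (\<lambda>n. \<sigma> n k) \<longlonglongrightarrow> a k" by metis
    have key: "\<exists>N. \<forall>n\<ge>N. summable (\<lambda>k. cmod (\<sigma> n k - a k) * \<omega> k) \<and>
                   (\<Sum>k. cmod (\<sigma> n k - a k) * \<omega> k) \<le> e" if "e > 0" for e
    proof -
      obtain N where N: "\<And>n m. n \<ge> N \<Longrightarrow> m \<ge> N \<Longrightarrow> (\<Sum>k. cmod (\<sigma> n k - \<sigma> m k) * \<omega> k) < e"
        using ev \<open>e > 0\<close> by blast
      have part: "(\<Sum>k<K. cmod (\<sigma> n k - a k) * \<omega> k) \<le> e" if "n \<ge> N" for n K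
      proof (rule tendsto_upperbound)
        show "(\<lambda>m. \<Sum>k<K. cmod (\<sigma> n k - \<sigma> m k) * \<omega> k) \<longlonglongrightarrow> (\<Sum>k<K. cmod (\<sigma> n k - a k) * \<omega> k)"
          by (intro tendsto_intros a)
        have "(\<Sum>k<K. cmod (\<sigma> n k - \<sigma> m k) * \<omega> k) \<le> e" if "m \<ge> N" for m
          using sum_le_suminf[OF D, of "{..<K}" n m] w0 N[OF \<open>n \<ge> N\<close> that] by fastforce
        then show "\<forall>\<^sub>F m in sequentially. (\<Sum>k<K. cmod (\<sigma> n k - \<sigma> m k) * \<omega> k) \<le> e"
          by (auto simp: eventually_sequentially)
      qed auto
      have "summable (\<lambda>k. cmod (\<sigma> n k - a k) * \<omega> k)" if "n \<ge> N" for n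
        by (rule summableI_nonneg_bounded[OF _ part[OF that]]) (use w0 in auto)
      moreover from this have "(\<Sum>k. cmod (\<sigma> n k - a k) * \<omega> k) \<le> e" if "n \<ge> N" for n
        using part that by (intro suminf_le_const) auto
      ultimately show ?thesis by blast
    qed
    obtain N where N: "summable (\<lambda>k. cmod (\<sigma> N k - a k) * \<omega> k)" using key[of 1] by auto
    have "a = \<sigma> N - (\<lambda>k. \<sigma> N k - a k)" by (simp add: fun_eq_iff)
    then have aL: "a \<in> vecs (l1_min \<omega>)"
      using normed_space_diff[OF l1_normed S[of N], of "\<lambda>k. \<sigma> N k - a k"] N by simp
    have "\<exists>N. \<forall>n\<ge>N. \<sigma> n \<in> vecs (l1_min \<omega>) \<and> ndist (l1_min \<omega>) (\<sigma> n) a < e" if e: "e > 0" for e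
    proof -
      obtain N where "\<forall>n\<ge>N. (\<Sum>k. cmod (\<sigma> n k - a k) * \<omega> k) \<le> e/2"
        using key[of "e/2"] e by auto
      with S aL e show ?thesis by (intro exI[of _ N]) (fastforce simp: ndist_def)
    qed
    with aL show ?thesis unfolding limit_metric_sequentially by blast
  qed
  then have mcomplete unfolding mcomplete_def by blast
  with l1_normed show ?thesis unfolding banach_space_def by (rule conjI)
qed

end

definition tl_sum :: "(nat \<Rightarrow> 'a::real_normed_vector) \<Rightarrow> nat \<Rightarrow> 'a" where
  "tl_sum a k = (\<Sum>n. a (n + k))"

lemma tl_sum_Suc:
  assumes "summable a" shows "tl_sum a k = a k + tl_sum a (Suc k)"
  using suminf_split_head[of "\<lambda>n. a (n + k)"] assms by (simp add: tl_sum_def summable_iff_shift)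

lemma tl_sum_0: "tl_sum a 0 = suminf a"
  by (simp add: tl_sum_def)

lemma tl_sum_lim:
  assumes "summable a" shows "tl_sum a \<longlonglongrightarrow> 0"
proof -
  have "tl_sum a = (\<lambda>k. suminf a - sum a {..<k})"
    using suminf_minus_initial_segment[OF assms] by (auto simp: tl_sum_def)
  moreover have "(\<lambda>k. suminf a - sum a {..<k}) \<longlonglongrightarrow> suminf a - suminf a"
    by (intro tendsto_intros summable_LIMSEQ assms)
  ultimately show ?thesis by simp
qed

text \<open>
  Since \<open>{(m, n). min m n = k}\<close> is the disjoint union of \<open>{k} \<times> {k..}\<close> and \<open>{Suc k..} \<times> {k}\<close>, the
  product is expressed by tail sums, and the tail sums are multiplicative.
\<close>

lemma mul_eq:
  assumes a: "summable (\<lambda>n. cmod (a n))" and b: "summable (\<lambda>n. cmod (b n))"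
  shows "mul (l1_min \<omega>) a b k = a k * tl_sum b k + tl_sum a (Suc k) * b k"
proof -
  have sa: "summable (\<lambda>n. cmod (a (n + Suc k)))" using a summable_iff_shift[of "\<lambda>n. cmod (a n)"] by blast
  have sb: "summable (\<lambda>n. cmod (b (n + k)))" using b summable_iff_shift[of "\<lambda>n. cmod (b n)"] by blast
  have 1: "((\<lambda>n. a k * b (n + k)) has_sum (a k * tl_sum b k)) UNIV"
    unfolding tl_sum_def
  proof (rule norm_summable_imp_has_sum)
    show "summable (\<lambda>n. cmod (a k * b (n + k)))" unfolding norm_mult by (rule summable_mult[OF sb])
    show "(\<lambda>n. a k * b (n + k)) sums (a k * (\<Sum>n. b (n + k)))"
      by (rule sums_mult[OF summable_sums[OF summable_norm_cancel[OF sb]]])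
  qed
  have 2: "((\<lambda>n. a (n + Suc k) * b k) has_sum (tl_sum a (Suc k) * b k)) UNIV"
    unfolding tl_sum_def
  proof (rule norm_summable_imp_has_sum)
    show "summable (\<lambda>n. cmod (a (n + Suc k) * b k))" unfolding norm_mult by (rule summable_mult2[OF sa])
    show "(\<lambda>n. a (n + Suc k) * b k) sums ((\<Sum>n. a (n + Suc k)) * b k)"
      by (rule sums_mult2[OF summable_sums[OF summable_norm_cancel[OF sa]]])
  qed
  have r1: "range (\<lambda>n. (k, n + k)) = {k} \<times> {k..}"
  proof safe
    fix n assume "k \<le> n"
    then have "(k, n) = (k, (n - k) + k)" by simp
    then show "(k, n) \<in> range (\<lambda>n. (k, n + k))" by blast
  qed auto
  have r2: "range (\<lambda>n. (n + Suc k, k)) = {Suc k..} \<times> {k}"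
  proof safe
    fix n assume "Suc k \<le> n"
    then have "(n, k) = ((n - Suc k) + Suc k, k)" by simp
    then show "(n, k) \<in> range (\<lambda>n. (n + Suc k, k))" by blast
  qed auto
  have 3: "((\<lambda>(m, n). a m * b n) has_sum (a k * tl_sum b k)) ({k} \<times> {k..})"
    unfolding r1[symmetric] by (subst has_sum_reindex) (use 1 in \<open>simp_all add: inj_on_def o_def\<close>)
  have 4: "((\<lambda>(m, n). a m * b n) has_sum (tl_sum a (Suc k) * b k)) ({Suc k..} \<times> {k})"
    unfolding r2[symmetric] by (subst has_sum_reindex) (use 2 in \<open>simp_all add: inj_on_def o_def\<close>)
  have "{(m, n). min m n = k} = {k} \<times> {k..} \<union> {Suc k..} \<times> {k}" by auto
  then have "((\<lambda>(m, n). a m * b n) has_sum (a k * tl_sum b k + tl_sum a (Suc k) * b k)) {(m, n). min m n = k}"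
    using has_sum_Un_disjoint[OF 3 4] by (simp add: Times_Int_Times)
  then show ?thesis unfolding l1_min_def by (simp add: infsumI)
qed

lemma sum_by_parts_tail:
  assumes a: "summable a" and b: "summable b"
  shows "(\<lambda>k. a k * tl_sum b k + tl_sum a (Suc k) * b k) sums (suminf a * suminf (b :: nat \<Rightarrow> 'a::{real_normed_field,banach}))"
proof -
  have "(\<lambda>k. tl_sum a k * tl_sum b k - tl_sum a (Suc k) * tl_sum b (Suc k)) sums
        (tl_sum a 0 * tl_sum b 0 - 0 * 0)"
    by (intro telescope_sums' tendsto_intros tl_sum_lim a b)
  moreover have "tl_sum a k * tl_sum b k - tl_sum a (Suc k) * tl_sum b (Suc k) =
        a k * tl_sum b k + tl_sum a (Suc k) * b k" for k
    using tl_sum_Suc[OF a, of k] tl_sum_Suc[OF b, of k] by (simp add: algebra_simps)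
  ultimately show ?thesis by (simp add: tl_sum_0)
qed

context l1_weight
begin

lemma l1_abs_summable:
  assumes "a \<in> vecs (l1_min \<omega>)" shows "summable (\<lambda>n. cmod (a n))"
proof (rule summable_comparison_test')
  show "summable (\<lambda>n. cmod (a n) * \<omega> n)" using assms by simp
  show "norm (cmod (a n)) \<le> cmod (a n) * \<omega> n" for n
    using mult_left_mono[OF w1[of n], of "cmod (a n)"] by simp
qed

lemmas l1_summable = summable_norm_cancel[OF l1_abs_summable]

lemma l1_mul_bound:
  assumes a: "a \<in> vecs (l1_min \<omega>)" and b: "b \<in> vecs (l1_min \<omega>)"
  shows "mul (l1_min \<omega>) a b \<in> vecs (l1_min \<omega>) \<and>
    nrm (l1_min \<omega>) (mul (l1_min \<omega>) a b) \<le> nrm (l1_min \<omega>) a * nrm (l1_min \<omega>) b"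
proof -
  define \<alpha> \<beta> where "\<alpha> = (\<lambda>n. cmod (a n) * \<omega> n)" and "\<beta> = (\<lambda>n. cmod (b n) * \<omega> n)"
  have s: "summable \<alpha>" "summable \<beta>" using a b by (simp_all add: \<alpha>_def \<beta>_def)
  have tl: "cmod (tl_sum c k) \<le> tl_sum (\<lambda>n. cmod (c n) * \<omega> n) k" if c: "c \<in> vecs (l1_min \<omega>)" for c k
  proof -
    have s1: "summable (\<lambda>n. cmod (c (n + k)))" using l1_abs_summable[OF c] summable_iff_shift[of "\<lambda>n. cmod (c n)"] by blast
    have s2: "summable (\<lambda>n. cmod (c (n + k)) * \<omega> (n + k))"
      using c summable_iff_shift[of "\<lambda>n. cmod (c n) * \<omega> n"] by simp
    have "cmod (tl_sum c k) \<le> (\<Sum>n. cmod (c (n + k)))"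
      unfolding tl_sum_def by (rule summable_norm[OF s1])
    also have "\<dots> \<le> (\<Sum>n. cmod (c (n + k)) * \<omega> (n + k))"
      by (rule suminf_le[OF _ s1 s2]) (use mult_left_mono[OF w1] in force)
    finally show ?thesis unfolding tl_sum_def .
  qed
  have le: "cmod (mul (l1_min \<omega>) a b k) * \<omega> k \<le> \<alpha> k * tl_sum \<beta> k + tl_sum \<alpha> (Suc k) * \<beta> k" for k
  proof -
    have "cmod (mul (l1_min \<omega>) a b k) \<le> cmod (a k) * cmod (tl_sum b k) + cmod (tl_sum a (Suc k)) * cmod (b k)"
      unfolding mul_eq[OF l1_abs_summable[OF a] l1_abs_summable[OF b]]
      by (metis norm_mult norm_triangle_ineq)
    also have "\<dots> \<le> cmod (a k) * tl_sum \<beta> k + tl_sum \<alpha> (Suc k) * cmod (b k)"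
      unfolding \<alpha>_def \<beta>_def by (intro add_mono mult_left_mono mult_right_mono tl a b) auto
    finally have "cmod (mul (l1_min \<omega>) a b k) * \<omega> k \<le>
      (cmod (a k) * tl_sum \<beta> k + tl_sum \<alpha> (Suc k) * cmod (b k)) * \<omega> k"
      by (rule mult_right_mono) (rule w0)
    then show ?thesis by (simp add: \<alpha>_def \<beta>_def algebra_simps)
  qed
  note sums = sum_by_parts_tail[OF s]
  have sm: "summable (\<lambda>k. cmod (mul (l1_min \<omega>) a b k) * \<omega> k)"
    by (rule summable_comparison_test'[OF sums_summable[OF sums]]) (use le w0 in \<open>auto simp: abs_mult\<close>)
  have "(\<Sum>k. cmod (mul (l1_min \<omega>) a b k) * \<omega> k) \<le> suminf \<alpha> * suminf \<beta>"
    unfolding sums_unique[OF sums] by (rule suminf_le[OF le sm sums_summable[OF sums]])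
  with sm show ?thesis by (simp add: \<alpha>_def \<beta>_def)
qed

lemma l1_mul_char:
  assumes a: "a \<in> vecs (l1_min \<omega>)" and b: "b \<in> vecs (l1_min \<omega>)"
  shows "tl_sum (mul (l1_min \<omega>) a b) k = tl_sum a k * tl_sum b k"
proof -
  have shift: "tl_sum (\<lambda>n. c (n + k)) j = tl_sum c (j + k)" for c :: "nat \<Rightarrow> complex" and j
    by (simp add: tl_sum_def algebra_simps)
  have "summable (\<lambda>n. a (n + k))" "summable (\<lambda>n. b (n + k))"
    using l1_summable a b by (simp_all add: summable_iff_shift)
  from sums_unique[OF sum_by_parts_tail[OF this]] show ?thesis
    by (simp add: shift mul_eq[OF l1_abs_summable[OF a] l1_abs_summable[OF b]] tl_sum_def[of _ k])
qed

lemma l1_char_inj: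
  assumes a: "a \<in> vecs (l1_min \<omega>)" and b: "b \<in> vecs (l1_min \<omega>)" and e: "\<And>k. tl_sum a k = tl_sum b k"
  shows "a = b"
proof
  fix k show "a k = b k"
    using tl_sum_Suc[OF l1_summable[OF a], of k] tl_sum_Suc[OF l1_summable[OF b], of k] e by simp
qed

lemma l1_tl_add:
  assumes a: "a \<in> vecs (l1_min \<omega>)" and b: "b \<in> vecs (l1_min \<omega>)"
  shows "tl_sum (a + b) k = tl_sum a k + tl_sum b k"
  using l1_summable[OF a] l1_summable[OF b] by (simp add: tl_sum_def suminf_add summable_iff_shift)

lemma l1_tl_scl:
  assumes a: "a \<in> vecs (l1_min \<omega>)"
  shows "tl_sum (\<lambda>n. c * a n) k = c * tl_sum a k"
  using l1_summable[OF a] by (simp add: tl_sum_def suminf_mult summable_iff_shift)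

lemma l1_banach_algebra: "banach_algebra (l1_min \<omega>)"
proof -
  note N = l1_normed
  have mem: "mul (l1_min \<omega>) a b \<in> vecs (l1_min \<omega>)" if "a \<in> vecs (l1_min \<omega>)" "b \<in> vecs (l1_min \<omega>)" for a b
    using l1_mul_bound[OF that] by blast
  have add: "a + b \<in> vecs (l1_min \<omega>)" if "a \<in> vecs (l1_min \<omega>)" "b \<in> vecs (l1_min \<omega>)" for a b
    using normed_space_add[OF N that] .
  have sc: "(\<lambda>n. c * a n) \<in> vecs (l1_min \<omega>)" if "a \<in> vecs (l1_min \<omega>)" for a c
    using normed_space_scl[OF N that, of c] by (simp only: l1_min_simps)
  have 1: "linear_map (l1_min \<omega>) (l1_min \<omega>) (mul (l1_min \<omega>) a)"
    "linear_map (l1_min \<omega>) (l1_min \<omega>) (\<lambda>b. mul (l1_min \<omega>) b a)" if a: "a \<in> vecs (l1_min \<omega>)" for a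
    unfolding linear_map_def l1_min_simps(2)
    by (intro conjI ballI allI l1_char_inj; use a mem add sc in
          \<open>auto simp del: l1_min_simps simp: l1_mul_char l1_tl_add l1_tl_scl algebra_simps\<close>)+
  have 2: "mul (l1_min \<omega>) (mul (l1_min \<omega>) a b) c = mul (l1_min \<omega>) a (mul (l1_min \<omega>) b c)"
    if a: "a \<in> vecs (l1_min \<omega>)" "b \<in> vecs (l1_min \<omega>)" "c \<in> vecs (l1_min \<omega>)" for a b c
    by (intro l1_char_inj) (use a mem in \<open>auto simp del: l1_min_simps simp: l1_mul_char\<close>)
  show ?thesis unfolding banach_algebra_def
    using l1_banach 1 2 l1_mul_bound by (intro conjI ballI) blast+
qed

end

lemma tendsto_zero_le_eps:
  assumes "\<And>e. e > 0 \<Longrightarrow> \<exists>M. \<forall>n\<ge>M. norm (f n) \<le> e" shows "f \<longlonglongrightarrow> 0"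
proof (rule LIMSEQ_I)
  fix r :: real assume "0 < r"
  with assms[of "r/2"] obtain M where "\<forall>n\<ge>M. norm (f n) \<le> r/2" by auto
  with \<open>0 < r\<close> show "\<exists>no. \<forall>n\<ge>no. norm (f n - 0) < r" by (intro exI[of _ M]) fastforce
qed

lemma eq_zero_le_eps: "(\<And>e. e > 0 \<Longrightarrow> norm x \<le> e * c) \<Longrightarrow> x = 0" for x :: "'a::real_normed_vector"
proof -
  assume a: "\<And>e. e > 0 \<Longrightarrow> norm x \<le> e * c"
  have "norm x \<le> 0"
  proof (rule field_le_epsilon)
    fix e :: real assume e: "e > 0"
    have "norm x \<le> (e / (\<bar>c\<bar> + 1)) * c" by (rule a) (use e in auto)
    also have "\<dots> \<le> e"
    proof -
      have "e * c \<le> e * (\<bar>c\<bar> + 1)" using e by (intro mult_left_mono) auto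
      then show ?thesis by (simp add: divide_simps)
    qed
    finally show "norm x \<le> 0 + e" by simp
  qed
  then show "x = 0" by simp
qed

definition delta :: "nat \<Rightarrow> nat \<Rightarrow> complex" where "delta n = (\<lambda>k. if k = n then 1 else 0)"
definition trunc :: "nat \<Rightarrow> (nat \<Rightarrow> complex) \<Rightarrow> nat \<Rightarrow> complex" where
  "trunc N b = (\<lambda>k. if k < N then b k else 0)"

lemma c0_inv_simps [simp]:
  "vecs (c0_inv \<omega>) = {b. (\<lambda>n. b n / of_real (\<omega> n)) \<longlonglongrightarrow> 0}"
  by (simp add: c0_inv_def)

context l1_weight
begin

abbreviation "L \<equiv> l1_min \<omega>"
abbreviation "\<phi> \<equiv> c0_functional \<omega>"
abbreviation "C0 \<equiv> vecs (c0_inv \<omega>)"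

lemma delta: "delta n \<in> vecs L" "nrm L (delta n) = \<omega> n"
proof -
  have "(\<lambda>k. cmod (delta n k) * \<omega> k) = (\<lambda>k. if k = n then \<omega> n else 0)" by (auto simp: delta_def)
  with sums_single[of n "\<lambda>_. \<omega> n"] show "delta n \<in> vecs L" "nrm L (delta n) = \<omega> n"
    by (auto simp: sums_iff)
qed

lemma C0_iff: "b \<in> C0 \<longleftrightarrow> (\<forall>e>0. \<exists>N. \<forall>n\<ge>N. cmod (b n) \<le> e * \<omega> n)"
proof -
  have *: "norm (b n / of_real (\<omega> n)) \<le> e \<longleftrightarrow> cmod (b n) \<le> e * \<omega> n" for n e
    using w0[of n] by (simp add: norm_divide divide_simps mult.commute)
  show ?thesis
  proof
    assume b: "b \<in> C0"
    show "\<forall>e>0. \<exists>N. \<forall>n\<ge>N. cmod (b n) \<le> e * \<omega> n"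
    proof safe
      fix e :: real assume "e > 0"
      then obtain N where "\<forall>n\<ge>N. norm (b n / of_real (\<omega> n)) < e" using b LIMSEQ_D[of "\<lambda>n. b n / of_real (\<omega> n)" 0 e] by auto
      then show "\<exists>N. \<forall>n\<ge>N. cmod (b n) \<le> e * \<omega> n" using * less_imp_le by blast
    qed
  next
    assume "\<forall>e>0. \<exists>N. \<forall>n\<ge>N. cmod (b n) \<le> e * \<omega> n"
    then show "b \<in> C0" using * by (auto intro!: tendsto_zero_le_eps)
  qed
qed

lemma C0_bound:
  assumes "b \<in> C0" obtains M where "0 \<le> M" "\<And>n. cmod (b n) \<le> M * \<omega> n"
proof -
  from assms have "Bseq (\<lambda>n. b n / of_real (\<omega> n))" by (auto intro!: convergent_imp_Bseq convergentI)
  then obtain M where M: "0 < M" "\<And>n. norm (b n / of_real (\<omega> n)) \<le> M" by (auto simp: Bseq_def)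
  have "cmod (b n) \<le> M * \<omega> n" for n
    using M(2)[of n] w0[of n] by (simp add: norm_divide divide_simps mult.commute)
  with M(1) show ?thesis by (intro that[of M]) auto
qed

lemma C0_add: "b \<in> C0 \<Longrightarrow> c \<in> C0 \<Longrightarrow> b + c \<in> C0"
  using tendsto_add[of "\<lambda>n. b n / of_real (\<omega> n)" 0 sequentially "\<lambda>n. c n / of_real (\<omega> n)" 0]
  by (simp add: add_divide_distrib)

lemma C0_scl: "b \<in> C0 \<Longrightarrow> (\<lambda>n. c * b n) \<in> C0"
  using tendsto_mult_left[of "\<lambda>n. b n / of_real (\<omega> n)" 0 sequentially c] by simp

lemma C0_trunc: "trunc N b \<in> C0"
  unfolding C0_iff by (auto simp: trunc_def intro!: exI[of _ N] mult_nonneg_nonneg w0)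

lemma pair:
  assumes a: "a \<in> vecs L" and M: "\<And>n. cmod (b n) \<le> M * \<omega> n"
  shows "summable (\<lambda>n. cmod (a n * b n))" "summable (\<lambda>n. a n * b n)"
    "cmod (\<Sum>n. a n * b n) \<le> M * nrm L a"
proof -
  have le: "cmod (a n * b n) \<le> M * (cmod (a n) * \<omega> n)" for n
    using mult_left_mono[OF M[of n], of "cmod (a n)"] by (simp add: norm_mult algebra_simps)
  have s: "summable (\<lambda>n. M * (cmod (a n) * \<omega> n))" using a by (auto intro: summable_mult)
  show 1: "summable (\<lambda>n. cmod (a n * b n))"
    by (rule summable_comparison_test'[OF s]) (use le in auto)
  then show "summable (\<lambda>n. a n * b n)" by (rule summable_norm_cancel)
  have "cmod (\<Sum>n. a n * b n) \<le> (\<Sum>n. cmod (a n * b n))" by (rule summable_norm[OF 1])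
  also have "\<dots> \<le> (\<Sum>n. M * (cmod (a n) * \<omega> n))" by (rule suminf_le[OF le 1 s])
  also have "\<dots> = M * nrm L a" using a by (simp add: suminf_mult)
  finally show "cmod (\<Sum>n. a n * b n) \<le> M * nrm L a" .
qed

lemma phi: "a \<in> vecs L \<Longrightarrow> \<phi> b a = (\<Sum>n. a n * b n)" "a \<notin> vecs L \<Longrightarrow> \<phi> b a = 0"
  by (simp_all add: c0_functional_def on_vecs_def)

lemma pairC0: "a \<in> vecs L \<Longrightarrow> b \<in> C0 \<Longrightarrow> summable (\<lambda>n. a n * b n)"
  by (metis C0_bound pair(2))

lemma phi_delta: "\<phi> b (delta n) = b n"
proof -
  have "(\<lambda>k. delta n k * b k) = (\<lambda>k. if k = n then b n else 0)" by (auto simp: delta_def)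
  then show ?thesis using phi(1)[OF delta(1)[of n], of b] sums_unique[OF sums_single[of n "\<lambda>_. b n"]]
    by simp
qed

lemma phi_add: "b \<in> C0 \<Longrightarrow> c \<in> C0 \<Longrightarrow> \<phi> (b + c) = \<phi> b + \<phi> c"
proof
  fix a assume bc: "b \<in> C0" "c \<in> C0"
  show "\<phi> (b + c) a = (\<phi> b + \<phi> c) a"
  proof (cases "a \<in> vecs L")
    case True
    then show ?thesis using suminf_add[OF pairC0[OF True bc(1)] pairC0[OF True bc(2)]]
      by (simp add: phi(1) distrib_left del: l1_min_simps)
  qed (simp add: phi(2) del: l1_min_simps)
qed

lemma phi_scl: "b \<in> C0 \<Longrightarrow> \<phi> (\<lambda>n. c * b n) = (\<lambda>a. c * \<phi> b a)"
proof
  fix a assume b: "b \<in> C0"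
  show "\<phi> (\<lambda>n. c * b n) a = c * \<phi> b a"
  proof (cases "a \<in> vecs L")
    case True
    then show ?thesis using suminf_mult[OF pairC0[OF True b], of c]
      by (simp add: phi(1) algebra_simps del: l1_min_simps)
  qed (simp add: phi(2) del: l1_min_simps)
qed

lemma phi_dual:
  assumes b: "b \<in> C0" shows "\<phi> b \<in> vecs (dual_space L)"
  unfolding mem_dual_space
proof (intro conjI ballI allI impI)
  show "\<phi> b a = 0" if "a \<notin> vecs L" for a by (rule phi(2)[OF that])
  obtain M where M: "\<And>n. cmod (b n) \<le> M * \<omega> n" using C0_bound[OF b] by metis
  then show "\<exists>K. \<forall>a\<in>vecs L. cmod (\<phi> b a) \<le> K * nrm L a"
    using pair(3)[OF _ M] by (metis phi(1))
  fix a assume a: "a \<in> vecs L"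
  show "\<phi> b (scl L c a) = c * \<phi> b a" for c
    unfolding phi(1)[OF a] phi(1)[OF normed_space_scl[OF l1_normed a]]
    using suminf_mult[OF pairC0[OF a b], of c] by (simp add: algebra_simps)
  fix a' assume a': "a' \<in> vecs L"
  show "\<phi> b (a + a') = \<phi> b a + \<phi> b a'"
    unfolding phi(1)[OF a] phi(1)[OF a'] phi(1)[OF normed_space_add[OF l1_normed a a']]
    using suminf_add[OF pairC0[OF a b] pairC0[OF a' b]] by (simp add: algebra_simps)
qed

lemma phi_nrm_le:
  assumes "0 \<le> M" "\<And>n. cmod (b n) \<le> M * \<omega> n"
  shows "nrm (dual_space L) (\<phi> b) \<le> M"
  by (rule dual_space_leI[OF l1_normed _ assms(1)]) (metis pair(3) assms(2) phi(1))

lemma dual_delta: "f \<in> vecs (dual_space L) \<Longrightarrow> cmod (f (delta n)) \<le> nrm (dual_space L) f * \<omega> n"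
  using dual_space_bound[OF l1_normed _ delta(1), of f n] delta(2) by simp

lemma predual_subspace: "module.subspace (scl (dual_space L)) (c0_predual \<omega>)"
proof -
  have s: "scl (dual_space L) = (\<lambda>c f x. c * f x)" by (simp add: dual_space_def)
  have "\<phi> 0 = 0" using phi_scl[of 0 0] by (auto simp: fun_eq_iff zero_fun_def)
  moreover have "0 \<in> C0" by simp
  ultimately show ?thesis unfolding s subspace_fun_def c0_predual_def
    using phi_add phi_scl C0_add C0_scl by (auto simp del: c0_inv_simps simp flip: phi_add phi_scl intro: rev_image_eqI)
qed

lemma predual_closed:
  "closedin (Metric_space.mtopology (vecs (dual_space L)) (ndist (dual_space L))) (c0_predual \<omega>)"
proof -
  interpret Metric_space "vecs (dual_space L)" "ndist (dual_space L)"
    by (rule Metric_space_ndist[OF dual_space_normed[OF l1_normed]])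
  have "f \<in> c0_predual \<omega>" if r: "range \<sigma> \<subseteq> c0_predual \<omega>" and l: "limitin mtopology \<sigma> f sequentially" for \<sigma> f
  proof -
    have "\<forall>j. \<exists>b. b \<in> C0 \<and> \<sigma> j = \<phi> b" using r by (fastforce simp: c0_predual_def)
    then obtain b where b: "\<And>j. b j \<in> C0" "\<And>j. \<sigma> j = \<phi> (b j)" by metis
    have f: "f \<in> vecs (dual_space L)" using l by (simp add: limit_metric_sequentially)
    have sd: "\<sigma> j - f \<in> vecs (dual_space L)" for j
      by (rule normed_space_diff[OF dual_space_normed[OF l1_normed] _ f]) (simp add: b phi_dual del: c0_inv_simps)
    have lim: "\<exists>j. nrm (dual_space L) (\<sigma> j - f) < e" if e: "e > 0" for e
    proof -
      obtain N where "\<forall>n\<ge>N. \<sigma> n \<in> vecs (dual_space L) \<and> ndist (dual_space L) (\<sigma> n) f < e"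
        using l e unfolding limit_metric_sequentially by metis
      then have "\<sigma> N \<in> vecs (dual_space L) \<and> ndist (dual_space L) (\<sigma> N) f < e" by blast
      then show ?thesis using f by (auto simp: ndist_def)
    qed
    define c where "c n = f (delta n)" for n
    have cb: "cmod (b j n - c n) \<le> nrm (dual_space L) (\<sigma> j - f) * \<omega> n" for j n
      using dual_delta[OF sd, of j n] by (simp add: b phi_delta c_def)
    have c0: "c \<in> C0" unfolding C0_iff
    proof safe
      fix e :: real assume e: "e > 0"
      then obtain j where j: "nrm (dual_space L) (\<sigma> j - f) < e/2" using lim[of "e/2"] by auto
      obtain N where N: "\<forall>n\<ge>N. cmod (b j n) \<le> e/2 * \<omega> n" using b(1)[of j] e unfolding C0_iff by (meson half_gt_zero)
      have "cmod (c n) \<le> e * \<omega> n" if "n \<ge> N" for n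
      proof -
        have "cmod (c n) \<le> cmod (b j n) + cmod (b j n - c n)"
          by (metis norm_minus_commute norm_triangle_sub add.commute)
        also have "\<dots> \<le> e/2 * \<omega> n + e/2 * \<omega> n"
          using N that cb[of j n] j mult_right_mono[OF less_imp_le[OF j] w0(2)[of n]] by force
        finally show ?thesis by simp
      qed
      then show "\<exists>N. \<forall>n\<ge>N. cmod (c n) \<le> e * \<omega> n" by blast
    qed
    have "f a = \<phi> c a" for a
    proof (cases "a \<in> vecs L")
      case a: True
      have "f a - \<phi> c a = 0"
      proof (rule eq_zero_le_eps[where c = "2 * nrm L a"])
        fix e :: real assume e: "e > 0"
        then obtain j where j: "nrm (dual_space L) (\<sigma> j - f) < e" using lim by auto
        have "cmod ((\<sigma> j - f) a) \<le> e * nrm L a"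
          using dual_space_bound[OF l1_normed sd a, of j] j mult_right_mono[of _ e "nrm L a"]
            l1_normed a unfolding normed_space_def by (smt (verit))
        moreover have "cmod (\<phi> (b j) a - \<phi> c a) \<le> e * nrm L a"
        proof -
          have "cmod (b j n - c n) \<le> e * \<omega> n" for n
            using cb[of j n] mult_right_mono[OF less_imp_le[OF j] w0(2)[of n]] by linarith
          from pair(3)[OF a this] show ?thesis
            unfolding phi(1)[OF a] suminf_diff[OF pairC0[OF a b(1)] pairC0[OF a c0]]
            by (simp add: right_diff_distrib)
        qed
        moreover have "f a - \<phi> c a = (\<phi> (b j) a - \<phi> c a) - (\<sigma> j - f) a" by (simp add: b)
        ultimately show "cmod (f a - \<phi> c a) \<le> e * (2 * nrm L a)"
          using norm_triangle_ineq4[of "\<phi> (b j) a - \<phi> c a" "(\<sigma> j - f) a"] by simp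
      qed
      then show ?thesis by simp
    next
      case False
      then show ?thesis using f phi(2) by (simp add: mem_dual_space)
    qed
    then have "f = \<phi> c" ..
    with c0 show ?thesis by (simp add: c0_predual_def)
  qed
  moreover have "c0_predual \<omega> \<subseteq> vecs (dual_space L)"
    using phi_dual by (auto simp: c0_predual_def simp del: c0_inv_simps)
  ultimately show ?thesis unfolding metric_closedin_iff_sequentially_closed by blast
qed

end

context l1_weight
begin

lemma l1_mul_commute: "a \<in> vecs L \<Longrightarrow> b \<in> vecs L \<Longrightarrow> mul L a b = mul L b a"
  using l1_mul_bound by (intro l1_char_inj) (auto simp del: l1_min_simps simp: l1_mul_char)

lemma l1_submodule:
  assumes w: "filterlim \<omega> at_top sequentially" and a: "a \<in> vecs L" and b: "b \<in> C0"
  shows "on_vecs L (\<lambda>x. \<phi> b (mul L x a)) \<in> c0_predual \<omega>"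
proof -
  define B where "B n = (\<Sum>k<n. a k * b k)" for n
  define c where "c n = tl_sum a n * b n + B n" for n
  have B: "B \<longlonglongrightarrow> (\<Sum>k. a k * b k)" unfolding B_def using summable_LIMSEQ[OF pairC0[OF a b]] .
  have T: "tl_sum a \<longlonglongrightarrow> 0" by (rule tl_sum_lim[OF l1_summable[OF a]])
  have winf: "filterlim (\<lambda>n. complex_of_real (\<omega> n)) at_infinity sequentially"
    by (rule filterlim_norm_at_top_imp_at_infinity) (use w w0(2) in simp)
  have Tb: "(\<lambda>n. tl_sum a n * b n) \<in> C0"
    using tendsto_mult[OF T, of "\<lambda>n. b n / of_real (\<omega> n)" 0] b by simp
  moreover have "B \<in> C0" using tendsto_divide_0[OF B winf] by simp
  ultimately have c: "c \<in> C0" using C0_add[OF Tb] by (simp add: c_def[abs_def] plus_fun_def del: c0_inv_simps)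
  have "\<phi> b (mul L x a) = \<phi> c x" if x: "x \<in> vecs L" for x
  proof -
    have "(\<lambda>k. tl_sum x k * B k - tl_sum x (Suc k) * B (Suc k)) sums (tl_sum x 0 * B 0 - 0 * (\<Sum>k. a k * b k))"
      by (intro telescope_sums' tendsto_intros B tl_sum_lim l1_summable x)
    moreover have "tl_sum x k * B k - tl_sum x (Suc k) * B (Suc k) = x k * B k - tl_sum x (Suc k) * a k * b k" for k
      using tl_sum_Suc[OF l1_summable[OF x], of k] by (simp add: B_def algebra_simps)
    ultimately have s: "(\<lambda>k. x k * B k - tl_sum x (Suc k) * a k * b k) sums 0" by (simp add: B_def)
    have "(\<lambda>k. x k * c k - (x k * B k - tl_sum x (Suc k) * a k * b k)) sums ((\<Sum>k. x k * c k) - 0)"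
      by (intro sums_diff s summable_sums pairC0 x c)
    moreover have "x k * c k - (x k * B k - tl_sum x (Suc k) * a k * b k) = mul L x a k * b k" for k
      unfolding mul_eq[OF l1_abs_summable[OF x] l1_abs_summable[OF a]] c_def by (simp add: algebra_simps)
    ultimately show ?thesis
      using l1_mul_bound[OF x a] x by (simp add: phi(1) sums_iff del: l1_min_simps)
  qed
  then have "on_vecs L (\<lambda>x. \<phi> b (mul L x a)) = \<phi> c"
    using phi(2) by (auto simp: on_vecs_def fun_eq_iff simp del: l1_min_simps)
  with c show ?thesis by (simp add: c0_predual_def)
qed

abbreviation "P \<equiv> (dual_space L)\<lparr>vecs := c0_predual \<omega>\<rparr>"
abbreviation "can \<equiv> (\<lambda>a. on_vecs P (\<lambda>f. f a))"

lemma P_normed: "normed_space P"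
proof -
  have "c0_predual \<omega> \<subseteq> vecs (dual_space L)"
    using phi_dual by (auto simp: c0_predual_def simp del: c0_inv_simps)
  then show ?thesis using dual_space_normed[OF l1_normed] predual_subspace
    unfolding normed_space_def by (simp del: l1_min_simps add: subset_iff)
qed

lemma P_vecs: "f \<in> vecs P \<longleftrightarrow> (\<exists>b\<in>C0. f = \<phi> b)"
  by (auto simp: c0_predual_def)

lemma can_phi: "b \<in> C0 \<Longrightarrow> can a (\<phi> b) = \<phi> b a"
  by (auto simp: on_vecs_def c0_predual_def simp del: c0_inv_simps)

lemma can_bound:
  assumes a: "a \<in> vecs L" and f: "f \<in> vecs P" shows "cmod (can a f) \<le> nrm L a * nrm P f"
proof -
  obtain b where b: "b \<in> C0" "f = \<phi> b" using f P_vecs by blast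
  show ?thesis using dual_space_bound[OF l1_normed phi_dual[OF b(1)] a]
    by (simp add: b(2) can_phi[OF b(1)] mult.commute del: l1_min_simps)
qed

lemma can_mem:
  assumes a: "a \<in> vecs L" shows "can a \<in> vecs (dual_space P)"
  unfolding mem_dual_space
proof (intro conjI ballI allI impI)
  show "\<exists>K. \<forall>f\<in>vecs P. cmod (can a f) \<le> K * nrm P f" using can_bound[OF a] by blast
  show "can a f = 0" if "f \<notin> vecs P" for f using that by (simp add: on_vecs_def)
  fix f assume f: "f \<in> vecs P"
  show "can a (scl P c f) = c * can a f" for c
    using f normed_space_scl[OF P_normed f, of c] by (simp add: on_vecs_def dual_space_def)
  fix g assume g: "g \<in> vecs P"
  show "can a (f + g) = can a f + can a g"
    using f g normed_space_add[OF P_normed f g] by (simp add: on_vecs_def)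
qed

lemma phi_trunc: "a \<in> vecs L \<Longrightarrow> \<phi> (trunc N b) a = (\<Sum>n<N. a n * b n)"
  by (subst phi(1), assumption, subst suminf_finite[of "{..<N}"]) (auto simp: trunc_def)

lemma trunc_sgn:
  defines "b \<equiv> \<lambda>z::nat \<Rightarrow> complex. \<lambda>n. cnj (sgn (z n)) * of_real (\<omega> n)"
  shows "cmod (trunc N (b z) n) \<le> 1 * \<omega> n" "z n * b z n = of_real (cmod (z n) * \<omega> n)"
proof -
  show "cmod (trunc N (b z) n) \<le> 1 * \<omega> n"
    using w0[of n] by (simp add: b_def trunc_def norm_mult norm_sgn)
  have "z n * cnj (sgn (z n)) = of_real (cmod (z n))"
    by (cases "z n = 0") (simp_all add: sgn_eq complex_norm_square[symmetric] power2_eq_square)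
  then show "z n * b z n = of_real (cmod (z n) * \<omega> n)" by (simp add: b_def mult.assoc[symmetric])
qed

lemma can_isometry:
  assumes a: "a \<in> vecs L" shows "nrm (dual_space P) (can a) = nrm L a"
proof (rule antisym)
  have "0 \<le> nrm L a" using l1_normed a unfolding normed_space_def by blast
  then show "nrm (dual_space P) (can a) \<le> nrm L a"
    using can_bound[OF a] by (intro dual_space_leI[OF P_normed]) auto
  have nn: "0 \<le> nrm (dual_space P) (can a)"
    using dual_space_normed[OF P_normed] can_mem[OF a] unfolding normed_space_def by blast
  have "(\<Sum>n<N. cmod (a n) * \<omega> n) \<le> nrm (dual_space P) (can a)" for N
  proof -
    define b where "b = trunc N (\<lambda>n. cnj (sgn (a n)) * of_real (\<omega> n))"
    have b: "b \<in> C0" unfolding b_def by (rule C0_trunc)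
    have n1: "nrm P (\<phi> b) \<le> 1" using phi_nrm_le[of 1 b] trunc_sgn(1) by (simp add: b_def)
    have "\<phi> b a = of_real (\<Sum>n<N. cmod (a n) * \<omega> n)"
      unfolding b_def phi_trunc[OF a] trunc_sgn(2) by simp
    moreover have "0 \<le> (\<Sum>n<N. cmod (a n) * \<omega> n)" by (intro sum_nonneg mult_nonneg_nonneg w0) auto
    ultimately have "(\<Sum>n<N. cmod (a n) * \<omega> n) = cmod (can a (\<phi> b))"
      by (simp only: can_phi[OF b] norm_of_real abs_of_nonneg)
    also have "\<dots> \<le> nrm (dual_space P) (can a) * nrm P (\<phi> b)"
      by (rule dual_space_bound[OF P_normed can_mem[OF a]]) (use b P_vecs in blast)
    also have "\<dots> \<le> nrm (dual_space P) (can a)" using n1 nn by (simp add: mult_left_le)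
    finally show ?thesis .
  qed
  then show "nrm L a \<le> nrm (dual_space P) (can a)"
    using a by (simp add: suminf_le_const)
qed

lemma can_surj:
  assumes F: "F \<in> vecs (dual_space P)" shows "\<exists>a\<in>vecs L. F = can a"
proof -
  define a where "a n = F (\<phi> (delta n))" for n
  have dC: "delta n \<in> C0" for n
    unfolding C0_iff by (auto simp: delta_def intro!: exI[of _ "Suc n"] mult_nonneg_nonneg w0)
  have F_add: "F (\<phi> (b + c)) = F (\<phi> b) + F (\<phi> c)" if "b \<in> C0" "c \<in> C0" for b c
  proof -
    have "\<phi> b \<in> vecs P" "\<phi> c \<in> vecs P" using that P_vecs by blast+
    then show ?thesis using F unfolding mem_dual_space phi_add[OF that] by blast
  qed
  have F_scl: "F (\<phi> (\<lambda>n. c * b n)) = c * F (\<phi> b)" if "b \<in> C0" for b c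
  proof -
    have "scl P c (\<phi> b) = \<phi> (\<lambda>n. c * b n)" using phi_scl[OF that] by (simp add: dual_space_def)
    moreover have "\<phi> b \<in> vecs P" using that P_vecs by blast
    ultimately show ?thesis using F unfolding mem_dual_space by metis
  qed
  have Ft: "F (\<phi> (trunc N b)) = (\<Sum>n<N. a n * b n)" for N b
  proof (induction N)
    case 0
    have "trunc 0 b = (\<lambda>n. 0 * delta 0 n)" by (simp add: trunc_def)
    then show ?case by (simp only: F_scl[OF dC]) simp
  next
    case (Suc N)
    have "trunc (Suc N) b = trunc N b + (\<lambda>n. b N * delta N n)"
      by (auto simp: trunc_def delta_def fun_eq_iff less_Suc_eq)
    then show ?case
      by (simp only: F_add[OF C0_trunc C0_scl[OF dC]] F_scl[OF dC] Suc) (simp add: a_def)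
  qed
  define K where "K = nrm (dual_space P) F"
  have K: "cmod (F (\<phi> b)) \<le> K * M" if "b \<in> C0" "0 \<le> M" "\<And>n. cmod (b n) \<le> M * \<omega> n" for b M
  proof -
    have "cmod (F (\<phi> b)) \<le> K * nrm P (\<phi> b)"
      unfolding K_def by (rule dual_space_bound[OF P_normed F]) (use that P_vecs in blast)
    also have "\<dots> \<le> K * M"
    proof (rule mult_left_mono)
      show "nrm P (\<phi> b) \<le> M" using phi_nrm_le[OF that(2,3)] by simp
      show "0 \<le> K" using dual_space_normed[OF P_normed] F unfolding normed_space_def K_def by blast
    qed
    finally show ?thesis .
  qed
  have part: "(\<Sum>n<N. cmod (a n) * \<omega> n) \<le> K" for N
  proof -
    have "F (\<phi> (trunc N (\<lambda>n. cnj (sgn (a n)) * of_real (\<omega> n)))) = of_real (\<Sum>n<N. cmod (a n) * \<omega> n)"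
      unfolding Ft trunc_sgn(2) by simp
    moreover have "0 \<le> (\<Sum>n<N. cmod (a n) * \<omega> n)" by (intro sum_nonneg mult_nonneg_nonneg w0) auto
    ultimately have "(\<Sum>n<N. cmod (a n) * \<omega> n) =
        cmod (F (\<phi> (trunc N (\<lambda>n. cnj (sgn (a n)) * of_real (\<omega> n)))))"
      by (simp only: norm_of_real abs_of_nonneg)
    also have "\<dots> \<le> K * 1" by (rule K[OF C0_trunc _ trunc_sgn(1)]) simp
    finally show ?thesis by simp
  qed
  have a: "a \<in> vecs L" using summableI_nonneg_bounded[OF _ part] w0 by simp
  have eq: "F (\<phi> b) = \<phi> b a" if b: "b \<in> C0" for b
  proof -
    have "(\<lambda>N. F (\<phi> (trunc N b)) - F (\<phi> b)) \<longlonglongrightarrow> 0"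
    proof (rule tendsto_zero_le_eps)
      fix e :: real assume e: "e > 0"
      have K0: "0 \<le> K" using part[of 0] by simp
      define e' where "e' = e / (K + 1)"
      have e': "e' > 0" "K * e' \<le> e" using e K0 by (simp_all add: e'_def divide_simps)
      obtain N where N: "\<And>n. n \<ge> N \<Longrightarrow> cmod (b n) \<le> e' * \<omega> n" using b e' unfolding C0_iff by blast
      have "cmod (F (\<phi> (trunc m b)) - F (\<phi> b)) \<le> e" if m: "m \<ge> N" for m
      proof -
        define r where "r = (\<lambda>n. (-1) * (b n - trunc m b n))"
        have "r = trunc m b + (\<lambda>n. (-1) * b n)" by (simp add: r_def fun_eq_iff)
        then have rC: "r \<in> C0" and "F (\<phi> r) = F (\<phi> (trunc m b)) - F (\<phi> b)"
          using C0_add[OF C0_trunc C0_scl[OF b, of "-1"]] F_add[OF C0_trunc C0_scl[OF b, of "-1"]] F_scl[OF b, of "-1"]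
          by (simp_all del: c0_inv_simps)
        moreover have "cmod (r n) \<le> e' * \<omega> n" for n
          using N[of n] m e'(1) w0[of n] by (auto simp: r_def trunc_def)
        ultimately show ?thesis using K[OF rC less_imp_le[OF e'(1)]] e'(2) by fastforce
      qed
      then show "\<exists>M. \<forall>n\<ge>M. cmod (F (\<phi> (trunc n b)) - F (\<phi> b)) \<le> e" by blast
    qed
    then have "(\<lambda>N. \<Sum>n<N. a n * b n) \<longlonglongrightarrow> F (\<phi> b)" unfolding Ft by (simp add: LIM_zero_iff)
    moreover have "(\<lambda>N. \<Sum>n<N. a n * b n) \<longlonglongrightarrow> \<phi> b a"
      unfolding phi(1)[OF a] by (rule summable_LIMSEQ[OF pairC0[OF a b]])
    ultimately show ?thesis by (rule LIMSEQ_unique)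
  qed
  have "F f = can a f" for f
  proof (cases "f \<in> vecs P")
    case True
    then obtain b where "b \<in> C0" "f = \<phi> b" using P_vecs by blast
    then show ?thesis by (simp only: can_phi eq)
  next
    case False
    then show ?thesis using F by (simp add: mem_dual_space on_vecs_def)
  qed
  with a show ?thesis by blast
qed

lemma can_inj: "inj_on can (vecs L)"
proof (rule inj_onI)
  fix a b assume a: "a \<in> vecs L" and b: "b \<in> vecs L" and e: "can a = can b"
  have dC: "trunc (Suc n) (delta n) \<in> C0" for n by (rule C0_trunc)
  have *: "c n = can c (\<phi> (trunc (Suc n) (delta n)))" if "c \<in> vecs L" for c n
    unfolding can_phi[OF dC] phi_trunc[OF that] by (simp add: delta_def)
  show "a = b"
  proof
    fix n
    have "a n = can a (\<phi> (trunc (Suc n) (delta n)))" by (rule *[OF a])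
    also have "\<dots> = can b (\<phi> (trunc (Suc n) (delta n)))" by (rule fun_cong[OF e])
    also have "\<dots> = b n" by (rule *[OF b, symmetric])
    finally show "a n = b n" .
  qed
qed

lemma l1_dual_banach_algebra:
  assumes w: "filterlim \<omega> at_top sequentially"
  shows "dual_banach_algebra L (c0_predual \<omega>)"
proof -
  note A = l1_banach_algebra
  define E where "E = self_bimodule L"
  have sel: "vecs E = vecs L" "scl E = scl L" "nrm E = nrm L" "lact E = mul L" "ract E = mul L"
    by (simp_all add: E_def self_bimodule_def)
  have lin: "linear_map E E f = linear_map L L f" "linear_map L E f = linear_map L L f" for f
    by (simp_all only: linear_map_def sel)
  have bs: "banach_space E = banach_space L"
  proof -
    have "ndist E = ndist L" by (intro ext) (simp only: ndist_def sel)
    then show ?thesis by (simp only: banach_space_def normed_space_def sel)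
  qed
  have ds: "dual_space E = dual_space L"
    by (simp only: dual_space_def bounded_linear_map_def linear_map_def on_vecs_def sel)
  have ov: "on_vecs E f = on_vecs L f" for f :: "(nat \<Rightarrow> complex) \<Rightarrow> complex" by (simp only: on_vecs_def sel)
  have bim: "banach_bimodule L E"
    unfolding banach_bimodule_def lin bs sel
  proof (intro conjI)
    show "\<exists>K. \<forall>a\<in>vecs L. \<forall>x\<in>vecs L. nrm L (mul L a x) \<le> K * nrm L a * nrm L x \<and> nrm L (mul L x a) \<le> K * nrm L a * nrm L x"
    proof (intro exI[of _ 1] ballI)
      fix a x assume ax: "a \<in> vecs L" "x \<in> vecs L"
      show "nrm L (mul L a x) \<le> 1 * nrm L a * nrm L x \<and> nrm L (mul L x a) \<le> 1 * nrm L a * nrm L x"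
        using l1_mul_bound[OF ax] l1_mul_commute[OF ax] by simp
    qed
  qed (use A in \<open>unfold banach_algebra_def, auto simp del: l1_min_simps\<close>)
  have sm: "on_vecs L (\<lambda>x. f (mul L x a)) \<in> c0_predual \<omega> \<and> on_vecs L (\<lambda>x. f (mul L a x)) \<in> c0_predual \<omega>"
    if a: "a \<in> vecs L" and f: "f \<in> c0_predual \<omega>" for a f
  proof -
    obtain b where b: "b \<in> C0" "f = \<phi> b" using f by (auto simp: c0_predual_def)
    have "on_vecs L (\<lambda>x. f (mul L a x)) = on_vecs L (\<lambda>x. f (mul L x a))"
      unfolding on_vecs_def by (intro ext if_cong refl arg_cong[of _ _ f] l1_mul_commute a)
    with l1_submodule[OF w a b(1)] b(2) show ?thesis by simp
  qed
  have "bij_betw can (vecs L) (vecs (dual_space P))"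
    unfolding bij_betw_def using can_inj can_mem can_surj by (blast intro: image_eqI)
  moreover have "c0_predual \<omega> \<subseteq> vecs (dual_space L)"
    using phi_dual by (auto simp: c0_predual_def simp del: c0_inv_simps)
  ultimately have "dual_bimodule L E (c0_predual \<omega>)"
    unfolding dual_bimodule_def Let_def ds ov sel
    using bim predual_subspace predual_closed sm can_isometry by (intro conjI) blast+
  with A show ?thesis by (simp only: dual_banach_algebra_def E_def)
qed

lemma c0_functional_isometry:
  assumes b: "b \<in> C0" shows "nrm (dual_space L) (\<phi> b) = nrm (c0_inv \<omega>) b"
proof (rule antisym)
  obtain M where M: "0 \<le> M" "\<And>n. cmod (b n) \<le> M * \<omega> n" using C0_bound[OF b] by metis
  have bdd: "bdd_above (range (\<lambda>n. cmod (b n) / \<omega> n))"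
    using M(2) w0 by (intro bdd_aboveI2[where M = M]) (simp add: divide_simps)
  have le: "cmod (b n) / \<omega> n \<le> nrm (c0_inv \<omega>) b" for n
    unfolding c0_inv_def using cSUP_upper[OF _ bdd, of n] by simp
  have "0 \<le> cmod (b 0) / \<omega> 0" using w0[of 0] by simp
  with le[of 0] have "0 \<le> nrm (c0_inv \<omega>) b" by linarith
  moreover have "cmod (b n) \<le> nrm (c0_inv \<omega>) b * \<omega> n" for n
    using le[of n] w0[of n] by (simp add: divide_simps)
  ultimately show "nrm (dual_space L) (\<phi> b) \<le> nrm (c0_inv \<omega>) b" by (rule phi_nrm_le)
  have "cmod (b n) / \<omega> n \<le> nrm (dual_space L) (\<phi> b)" for n
    using dual_delta[OF phi_dual[OF b], of n] w0[of n] by (simp add: phi_delta divide_simps)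
  then show "nrm (c0_inv \<omega>) b \<le> nrm (dual_space L) (\<phi> b)"
    unfolding c0_inv_def by (auto intro!: cSUP_least)
qed

end

theorem l1_min_dual_banach_algebra:
  fixes \<omega> :: "nat \<Rightarrow> real"
  assumes "\<And>n. 1 \<le> \<omega> n" and "filterlim \<omega> at_top sequentially"
  shows "dual_banach_algebra (l1_min \<omega>) (c0_predual \<omega>)"
  using l1_weight.l1_dual_banach_algebra[OF l1_weight.intro] assms by blast

declare l1_min_simps [simp del] c0_inv_simps [simp del]

end

theory Submission
  imports Defs
begin

text \<open>
  The tail sums \<open>tl_sum a k\<close> are the Gelfand transform of \<open>\<ell>\<^sup>1(\<nat>\<^sub>\<and>, \<omega>)\<close>: they are multiplicative,
  determine \<open>a\<close> because \<open>a k = tl_sum a k - tl_sum a (Suc k)\<close>, and tend to 0.  So \<open>\<ell>\<^sup>1(\<nat>\<^sub>\<and>, \<omega>)\<close> is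
  the algebra of null sequences \<open>c\<close> of finite weighted variation \<open>\<Sum>k. |c k - c (Suc k)| * \<omega> k\<close>,
  with pointwise multiplication.

  Pointwise Connes amenability fails because there is no local identity.  Any dual Banach algebra \<open>A\<close>
  is a normal dual bimodule over itself when the right action is replaced by 0, and then the identity
  map is a \<open>w\<^sup>*\<close>-continuous derivation.  It is inner at \<open>a\<close> precisely if \<open>a \<cdot> e = a\<close> for
  some \<open>e\<close> (\<open>pointwise_connes_amenable_imp_right_identity\<close>).  For the present algebra, if the transform
  of \<open>a\<close> has no zero, then that of \<open>e\<close> would have to be constantly 1, which is not a null
  sequence (\<open>l1_no_right_identity\<close>).

  The positive part holds even with norm approximation.  Fix \<open>a\<close> with transform \<open>c\<close> and a derivation
  \<open>D\<close>.  The naive approach, which averages \<open>D\<close> over the finite-dimensional subalgebras spanned by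
  \<open>\<delta>\<^sub>0, \<dots>, \<delta>\<^sub>n\<close>, leaves errors multiplied by powers of \<open>\<omega> n\<close>, which are unbounded.  Instead the
  functional calculus of the single element \<open>a\<close> is used.

  For \<open>l \<noteq> 0\<close>, the level set \<open>{k. c k = l}\<close> is finite, and its indicator is the transform of an
  idempotent \<open>p\<close>, the spectral idempotent of \<open>a\<close> at \<open>l\<close>.  The element \<open>D p\<close> is exactly of the form
  \<open>a \<cdot> x - x \<cdot> a\<close>: the off-diagonal parts of \<open>D p\<close> lie in \<open>p \<cdot> E \<cdot> (1 - p)\<close> and
  \<open>(1 - p) \<cdot> E \<cdot> p\<close>, its diagonal parts vanish, and \<open>l - a\<close> is invertible on the range of
  \<open>1 - p\<close> (\<open>inner_at_idempotent\<close>, \<open>derivation_spectral_idempotent\<close>).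

  Hence it suffices that \<open>a\<close> lies in the closed span of its spectral idempotents
  (\<open>l1_spectral_approximation\<close>).  Let \<open>r\<close> be the projection of the plane onto the disc of radius
  \<open>\<epsilon>\<close>.  The sequence \<open>c k - r (c k)\<close> takes finitely many nonzero values, so it is the transform of a
  combination of spectral idempotents; and as \<open>r\<close> is a contraction, the variation of \<open>r (c k)\<close> is
  dominated by that of \<open>c\<close> and tends to 0 with \<open>\<epsilon>\<close>.
\<close>

section \<open>Pointwise Connes amenability forces local identities\<close>

lemma dual_bimodule_zero_right_action:
  assumes "dual_bimodule A E P"
  shows "dual_bimodule A (E\<lparr>ract := \<lambda>_ _. 0\<rparr>) P"
proof -
  define F where "F = E\<lparr>ract := \<lambda>_ _. 0\<rparr>"
  have F: "vecs F = vecs E" "scl F = scl E" "nrm F = nrm E" "lact F = lact E" "ract F = (\<lambda>_ _. 0)"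
    by (simp_all add: F_def)
  have lin: "linear_map F F f = linear_map E E f" "linear_map A F g = linear_map A E g" for f g
    by (simp_all only: linear_map_def F)
  have dist: "ndist F = ndist E" by (intro ext) (simp only: ndist_def F)
  have banach: "banach_space F = banach_space E"
    by (simp only: banach_space_def normed_space_def F dist)
  have dual: "dual_space F = dual_space E"
    by (simp only: dual_space_def bounded_linear_map_def linear_map_def on_vecs_def F)
  have on_vecs: "on_vecs F f = on_vecs E f" for f
    by (simp only: on_vecs_def F)
  have E: "banach_bimodule A E" and PE: "P \<subseteq> vecs (dual_space E)"
      and subP: "module.subspace (scl (dual_space E)) P"
    using assms by (simp_all only: dual_bimodule_def)
  then have N: "normed_space E" by (simp add: banach_bimodule_def banach_space_def)
  have "vector_space (scl E)" using N by (simp add: normed_space_def)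
  then have z: "scl E c 0 = 0" for c
    by (metis module.scale_zero_right module_iff_vector_space)
  have n0: "nrm E 0 = 0" using N normed_space_zero[OF N] by (simp add: normed_space_def)
  have lin0: "linear_map E E (\<lambda>_. 0)" "linear_map A E (\<lambda>_. 0)"
    using z normed_space_zero[OF N] by (auto simp: linear_map_def)
  have l0: "lact E a 0 = 0" if "a \<in> vecs A" for a
  proof -
    have "linear_map E E (lact E a)" using E that by (simp add: banach_bimodule_def)
    then have "lact E a (0 + 0) = lact E a 0 + lact E a 0"
      using normed_space_zero[OF N] unfolding linear_map_def by blast
    then show ?thesis by simp
  qed
  obtain K where K: "\<And>a x. a \<in> vecs A \<Longrightarrow> x \<in> vecs E \<Longrightarrow>
      nrm E (lact E a x) \<le> K * nrm A a * nrm E x \<and> nrm E (ract E x a) \<le> K * nrm A a * nrm E x"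
    using E unfolding banach_bimodule_def by blast
  have K0: "nrm E 0 \<le> K * nrm A a * nrm E x" if "a \<in> vecs A" "x \<in> vecs E" for a x
  proof -
    have "linear_map E E (lact E a)" using E that by (simp add: banach_bimodule_def)
    then have "lact E a x \<in> vecs E" using that unfolding linear_map_def by blast
    then have "0 \<le> nrm E (lact E a x)" using N by (simp add: normed_space_def)
    then show ?thesis using K[OF that] n0 by linarith
  qed
  have parts: "banach_space E"
      "\<And>a. a \<in> vecs A \<Longrightarrow> linear_map E E (lact E a)"
      "\<And>x. x \<in> vecs E \<Longrightarrow> linear_map A E (\<lambda>a. lact E a x)"
      "\<And>a b x. a \<in> vecs A \<Longrightarrow> b \<in> vecs A \<Longrightarrow> x \<in> vecs E \<Longrightarrow>
        lact E (mul A a b) x = lact E a (lact E b x)"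
    using E by (simp_all add: banach_bimodule_def)
  have bim: "banach_bimodule A F"
    unfolding banach_bimodule_def lin banach F
  proof (intro conjI)
    show "\<exists>K. \<forall>a\<in>vecs A. \<forall>x\<in>vecs E. nrm E (lact E a x) \<le> K * nrm A a * nrm E x \<and>
          nrm E 0 \<le> K * nrm A a * nrm E x"
      using K K0 by blast
  qed (simp_all add: parts lin0 l0)
  have zero: "on_vecs E (\<lambda>x. f 0) \<in> P" if "f \<in> P" for f
  proof -
    have "f (0 + 0) = f 0 + f 0"
      using that PE normed_space_zero[OF N] unfolding mem_dual_space subset_iff by blast
    then have "on_vecs E (\<lambda>x. f 0) = 0" by (auto simp: on_vecs_def)
    moreover have "0 \<in> P"
      using subP unfolding dual_space_def nspace.simps subspace_fun_def by blast
    ultimately show ?thesis by simp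
  qed
  have "\<forall>a\<in>vecs A. \<forall>f\<in>P. on_vecs E (\<lambda>x. f 0) \<in> P \<and> on_vecs E (\<lambda>x. f (lact E a x)) \<in> P"
    using assms zero by (simp add: dual_bimodule_def)
  then have "dual_bimodule A F P"
    unfolding dual_bimodule_def dual on_vecs F
    using assms[unfolded dual_bimodule_def] by (simp only: bim simp_thms)
  then show ?thesis by (simp only: F_def)
qed

lemma wstar_topspace:
  assumes "P \<noteq> {}" shows "topspace (wstar E P) = vecs E"
proof -
  obtain f where "f \<in> P" using assms by blast
  then have "{x \<in> vecs E. f x \<in> UNIV} \<in> {{x \<in> vecs E. f x \<in> U} |f U. f \<in> P \<and> open U}" by blast
  then have "vecs E \<in> {{x \<in> vecs E. f x \<in> U} |f U. f \<in> P \<and> open U}" by simp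
  then show ?thesis by (auto simp: wstar_def)
qed

lemma wstar_subbasis: "f \<in> P \<Longrightarrow> open U \<Longrightarrow> openin (wstar E P) {x \<in> vecs E. f x \<in> U}"
  unfolding wstar_def by (rule topology_generated_by_Basis) blast

text \<open>An operator is \<open>w\<^sup>*\<close>-continuous if its adjoint maps one predual into the other.\<close>

lemma continuous_map_wstar:
  assumes "P \<noteq> {}" "Q \<noteq> {}" and "T \<in> vecs E \<rightarrow> vecs F"
    and "\<And>f. f \<in> Q \<Longrightarrow> on_vecs E (f \<circ> T) \<in> P"
  shows "continuous_map (wstar E P) (wstar F Q) T"
proof -
  have top: "topspace (wstar E P) = vecs E" by (rule wstar_topspace[OF assms(1)])
  show ?thesis
    unfolding wstar_def[of F Q] continuous_on_generated_topo_iff top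
  proof (intro conjI allI impI)
    fix W assume "W \<in> {{x \<in> vecs F. f x \<in> U} |f U. f \<in> Q \<and> open U}"
    then obtain f U where fU: "f \<in> Q" "open U" and W: "W = {x \<in> vecs F. f x \<in> U}" by blast
    have "T -` W \<inter> vecs E = {x \<in> vecs E. on_vecs E (f \<circ> T) x \<in> U}"
      using assms(3) by (auto simp: W on_vecs_def)
    then show "openin (wstar E P) (T -` W \<inter> vecs E)"
      using wstar_subbasis[OF assms(4)[OF fU(1)] fU(2)] by simp
  next
    show "T ` vecs E \<subseteq> \<Union> {{x \<in> vecs F. f x \<in> U} |f U. f \<in> Q \<and> open U}"
      using wstar_topspace[OF assms(2), of F] assms(3) by (auto simp: wstar_def)
  qed
qed

text \<open>
  On \<open>A\<close> with multiplication as left action and right action 0, the derivation identity reads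
  \<open>D (a b) = a \<cdot> D b\<close> and thus holds for the identity map, while inner derivations are the right
  multiplications \<open>a \<mapsto> a e\<close>.
\<close>

lemma pointwise_connes_amenable_imp_right_identity:
  fixes A :: "'a::ab_group_add nalgebra"
  assumes A: "dual_banach_algebra A P"
    and pc: "pointwise_connes_amenable TYPE('a) A P"
    and a: "a \<in> vecs A"
  shows "\<exists>e\<in>vecs A. mul A a e = a"
proof -
  define E where "E = (self_bimodule A)\<lparr>ract := \<lambda>_ _. 0\<rparr>"
  have E: "vecs E = vecs A" "scl E = scl A" "nrm E = nrm A" "lact E = mul A" "ract E = (\<lambda>_ _. 0)"
    by (simp_all add: E_def self_bimodule_def)
  have B: "banach_algebra A" and S: "dual_bimodule A (self_bimodule A) P"
    using A by (simp_all only: dual_banach_algebra_def)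
  have dual: "dual_bimodule A E P"
    unfolding E_def by (rule dual_bimodule_zero_right_action[OF S])
  then have "module.subspace (\<lambda>c f x. c * f x) P"
    unfolding dual_bimodule_def by (simp add: dual_space_def)
  then have zP: "0 \<in> P" unfolding subspace_fun_def by blast
  have zA: "0 \<in> vecs A"
    using B by (simp add: banach_algebra_def banach_space_def normed_space_zero)
  have PE: "on_vecs E f = f" if "f \<in> P" for f
    using dual that by (auto simp: dual_bimodule_def dual_space_def)
  have on_vecs: "on_vecs A f = on_vecs E f" for f by (simp only: on_vecs_def E)
  have acts: "continuous_map (wstar A P) (wstar E P) (\<lambda>b. lact E b x)"
      "continuous_map (wstar A P) (wstar E P) (\<lambda>b. ract E x b)" if x: "x \<in> vecs E" for x
  proof -
    have "linear_map A A (\<lambda>b. mul A b x)" using B x by (simp add: banach_algebra_def E)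
    then have mem: "mul A b x \<in> vecs A" if "b \<in> vecs A" for b
      using that unfolding linear_map_def by blast
    show "continuous_map (wstar A P) (wstar E P) (\<lambda>b. lact E b x)"
    proof (rule continuous_map_wstar)
      fix f assume "f \<in> P"
      then have "on_vecs (self_bimodule A) (\<lambda>b. f (mul A b x)) \<in> P"
        using S x unfolding dual_bimodule_def E by (simp add: self_bimodule_def)
      then show "on_vecs A (f \<circ> (\<lambda>b. lact E b x)) \<in> P"
        by (simp add: on_vecs_def self_bimodule_def E o_def)
    qed (use zP mem in \<open>auto simp: E\<close>)
    show "continuous_map (wstar A P) (wstar E P) (\<lambda>b. ract E x b)"
    proof (rule continuous_map_wstar)
      fix f assume "f \<in> P"
      then have "on_vecs E (\<lambda>b. f (ract E b 0)) \<in> P"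
        using dual zA by (simp add: dual_bimodule_def)
      then show "on_vecs A (f \<circ> (\<lambda>b. ract E x b)) \<in> P"
        by (simp add: on_vecs E o_def)
    qed (use zP zA in \<open>auto simp: E\<close>)
  qed
  have idc: "continuous_map (wstar A P) (wstar E P) (\<lambda>b. b)"
    by (rule continuous_map_wstar) (use zP PE in \<open>auto simp: E on_vecs o_def\<close>)
  have "derivation A E (\<lambda>b. b)"
    unfolding derivation_def bounded_linear_map_def linear_map_def E
    by (intro conjI exI[of _ 1]) auto
  with idc have "wstar_derivation A P E P (\<lambda>b. b)" by (simp add: wstar_derivation_def)
  moreover have "normal_dual_bimodule A P E P"
    using dual acts by (simp add: normal_dual_bimodule_def)
  ultimately obtain x where "x \<in> vecs E" "a = lact E a x - ract E x a"
    using pc[unfolded pointwise_connes_amenable_def, rule_format, OF a, of E P "\<lambda>b. b"] by auto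
  then have "x \<in> vecs A" "mul A a x = a" by (simp_all add: E)
  then show ?thesis by blast
qed

context l1_weight
begin

text \<open>
  If \<open>a \<cdot> e = a\<close>, then \<open>tl_sum a k * tl_sum e k = tl_sum a k\<close> for all \<open>k\<close>.  If the transform of
  \<open>a\<close> has no zero, then the transform of \<open>e\<close> is constantly 1, although tail sums tend to 0.
\<close>

lemma l1_no_right_identity:
  "\<exists>a\<in>vecs L. \<forall>e\<in>vecs L. mul L a e \<noteq> a"
proof -
  \<comment> \<open>Positive coefficients make all tail sums nonzero.\<close>
  define r :: "nat \<Rightarrow> real" where "r n = (1/2) ^ n / \<omega> n" for n
  have r0: "0 < r n" for n using w0[of n] by (simp add: r_def)
  define a where "a n = complex_of_real (r n)" for n
  have "cmod (a n) * \<omega> n = (1/2) ^ n" for n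
    using r0[of n] w0[of n] unfolding a_def norm_of_real by (simp add: r_def)
  then have a: "a \<in> vecs L" by (simp add: l1_min_simps summable_geometric)
  have tl: "tl_sum a k \<noteq> 0" for k
  proof -
    have "summable r" using l1_abs_summable[OF a] r0 by (simp add: a_def less_imp_le)
    then have s: "summable (\<lambda>n. r (n + k))" by (simp add: summable_iff_shift)
    have "tl_sum a k = of_real (tl_sum r k)"
      unfolding tl_sum_def a_def by (rule suminf_of_real[OF s, symmetric])
    moreover have "0 < tl_sum r k" unfolding tl_sum_def by (rule suminf_pos[OF s r0])
    ultimately show ?thesis by simp
  qed
  have "mul L a e \<noteq> a" if e: "e \<in> vecs L" for e
  proof
    assume "mul L a e = a"
    then have "tl_sum a k * tl_sum e k = tl_sum a k" for k by (metis l1_mul_char a e)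
    then have "tl_sum e = (\<lambda>k. 1)" using tl by (auto simp: fun_eq_iff)
    with tl_sum_lim[OF l1_summable[OF e]] show False by (simp add: LIMSEQ_const_iff)
  qed
  with a show ?thesis by blast
qed

end

section \<open>Derivations at spectral idempotents\<close>

definition inner_at ::
    "('a::ab_group_add, 'z) nalgebra_scheme \<Rightarrow> ('a, 'e::ab_group_add) bimodule \<Rightarrow> 'a \<Rightarrow> 'e set" where
  "inner_at A E a = {lact E a x - ract E x a |x. x \<in> vecs E}"

lemma linear_map_closed: "linear_map F G f \<Longrightarrow> x \<in> vecs F \<Longrightarrow> f x \<in> vecs G"
  unfolding linear_map_def by blast

lemma linear_map_add:
  "linear_map F G f \<Longrightarrow> x \<in> vecs F \<Longrightarrow> y \<in> vecs F \<Longrightarrow> f (x + y) = f x + f y"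
  unfolding linear_map_def by blast

lemma linear_map_scl:
  "linear_map F G f \<Longrightarrow> x \<in> vecs F \<Longrightarrow> f (scl F c x) = scl G c (f x)"
  unfolding linear_map_def by blast

lemma linear_map_diff:
  assumes "linear_map F G f" "normed_space F" "x \<in> vecs F" "y \<in> vecs F"
  shows "f (x - y) = f x - f y"
  using linear_map_add[OF assms(1) normed_space_diff[OF assms(2-4)] assms(4)] by simp

locale banach_derivation =
  fixes A :: "'a::ab_group_add nalgebra" and E :: "('a, 'e::ab_group_add) bimodule" and D
  assumes algebra: "banach_algebra A" and bimodule: "banach_bimodule A E"
    and derivation: "derivation A E D"
begin

abbreviation left (infixr "\<triangleright>" 76) where "a \<triangleright> x \<equiv> lact E a x"
abbreviation right (infixl "\<triangleleft>" 75) where "x \<triangleleft> a \<equiv> ract E x a"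

lemma normed: "normed_space A" "normed_space E"
  using algebra bimodule by (simp_all add: banach_algebra_def banach_bimodule_def banach_space_def)

lemma scalars: "vector_space (scl E)"
  using normed(2) by (simp add: normed_space_def)

sublocale E: vector_space "scl E" by (rule scalars)

lemma maps:
  shows "a \<in> vecs A \<Longrightarrow> linear_map E E (lact E a)"
    and "a \<in> vecs A \<Longrightarrow> linear_map E E (\<lambda>x. x \<triangleleft> a)"
    and "x \<in> vecs E \<Longrightarrow> linear_map A E (\<lambda>a. a \<triangleright> x)"
    and "x \<in> vecs E \<Longrightarrow> linear_map A E (ract E x)"
    and "linear_map A E D"
  using bimodule derivation
  by (simp_all add: banach_bimodule_def derivation_def bounded_linear_map_def)

lemma mem [simp]:
  "a \<in> vecs A \<Longrightarrow> x \<in> vecs E \<Longrightarrow> a \<triangleright> x \<in> vecs E"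
  "a \<in> vecs A \<Longrightarrow> x \<in> vecs E \<Longrightarrow> x \<triangleleft> a \<in> vecs E"
  "a \<in> vecs A \<Longrightarrow> D a \<in> vecs E"
  by (rule linear_map_closed[OF maps(1)] linear_map_closed[OF maps(2)] linear_map_closed[OF maps(5)]; assumption)+

lemma closed [simp]:
  "x \<in> vecs E \<Longrightarrow> y \<in> vecs E \<Longrightarrow> x + y \<in> vecs E"
  "x \<in> vecs E \<Longrightarrow> y \<in> vecs E \<Longrightarrow> x - y \<in> vecs E"
  "x \<in> vecs E \<Longrightarrow> scl E c x \<in> vecs E"
  "a \<in> vecs A \<Longrightarrow> b \<in> vecs A \<Longrightarrow> a + b \<in> vecs A"
  "a \<in> vecs A \<Longrightarrow> b \<in> vecs A \<Longrightarrow> a - b \<in> vecs A"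
  "a \<in> vecs A \<Longrightarrow> scl A c a \<in> vecs A"
  "0 \<in> vecs A" "0 \<in> vecs E"
  using normed normed_space_zero normed_space_add normed_space_diff normed_space_scl by blast+

lemmas act_add =
  linear_map_add[OF maps(1)] linear_map_add[OF maps(2)] linear_map_add[OF maps(3)] linear_map_add[OF maps(4)]
lemmas act_diff =
  linear_map_diff[OF maps(1) normed(2)] linear_map_diff[OF maps(2) normed(2)]
  linear_map_diff[OF maps(3) normed(1)] linear_map_diff[OF maps(4) normed(1)]
lemmas act_scl =
  linear_map_scl[OF maps(1)] linear_map_scl[OF maps(2)] linear_map_scl[OF maps(3)] linear_map_scl[OF maps(4)]

lemma act_mul:
  assumes "a \<in> vecs A" "b \<in> vecs A" "x \<in> vecs E"
  shows "mul A a b \<triangleright> x = a \<triangleright> (b \<triangleright> x)" "x \<triangleleft> mul A a b = (x \<triangleleft> a) \<triangleleft> b" "(a \<triangleright> x) \<triangleleft> b = a \<triangleright> (x \<triangleleft> b)"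
  using bimodule assms by (simp_all add: banach_bimodule_def)

lemma D_mul: "a \<in> vecs A \<Longrightarrow> b \<in> vecs A \<Longrightarrow> D (mul A a b) = D a \<triangleleft> b + a \<triangleright> D b"
  using derivation by (simp add: derivation_def)

lemma inner_at_subspace: "E.subspace (inner_at A E a)" if a: "a \<in> vecs A"
  unfolding E.subspace_def
proof (intro conjI ballI allI)
  have "0 = a \<triangleright> 0 - 0 \<triangleleft> a" using act_diff(1,2)[of a 0 0] a by simp
  then show "0 \<in> inner_at A E a" unfolding inner_at_def using closed(8) by blast
  fix y c assume "y \<in> inner_at A E a"
  then obtain x where x: "x \<in> vecs E" "y = a \<triangleright> x - x \<triangleleft> a" by (auto simp: inner_at_def)
  then have "scl E c y = a \<triangleright> scl E c x - scl E c x \<triangleleft> a"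
    using a by (simp add: act_scl E.scale_right_diff_distrib)
  then show "scl E c y \<in> inner_at A E a" unfolding inner_at_def using x closed(3) by blast
  fix y' assume "y' \<in> inner_at A E a"
  then obtain x' where x': "x' \<in> vecs E" "y' = a \<triangleright> x' - x' \<triangleleft> a" by (auto simp: inner_at_def)
  then have "y + y' = a \<triangleright> (x + x') - (x + x') \<triangleleft> a"
    using a x by (simp add: act_add)
  then show "y + y' \<in> inner_at A E a" unfolding inner_at_def using x x' closed(1) by blast
qed

text \<open>
  The hypotheses say that \<open>p\<close> is an idempotent on whose range \<open>a\<close> acts as the scalar \<open>l\<close>, and that
  \<open>1 + h\<close> is \<open>l\<close> times the inverse of \<open>l - a\<close> on the range of \<open>1 - p\<close> and vanishes on the range
  of \<open>p\<close>: that is, \<open>(1 + h) p = 0\<close> and \<open>(l - a) (1 + h) = l (1 - p)\<close>, written without the adjoined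
  identity.  Put \<open>w = 1 + h\<close>.  The derivation identity gives \<open>D p = D p \<cdot> p + p \<cdot> D p\<close>, hence
  \<open>p \<cdot> D p \<cdot> p = 0\<close>.  For \<open>y = p \<cdot> D p \<cdot> w - w \<cdot> D p\<close>, commutation with \<open>a\<close> multiplies the first
  term, which has \<open>p\<close> on its left, by \<open>l - a\<close> on the right and so turns it into \<open>l p \<cdot> D p\<close>;
  likewise it turns the second, which equals \<open>w \<cdot> D p \<cdot> p\<close>, into \<open>l D p \<cdot> p\<close>.  The sum of both is
  \<open>l D p\<close>.
\<close>

lemma inner_at_idempotent:
  assumes mem: "a \<in> vecs A" "p \<in> vecs A" "h \<in> vecs A" and l: "l \<noteq> 0"
    and p: "mul A p p = p" "mul A a p = scl A l p" "mul A p a = scl A l p"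
    and h: "mul A h p = - p" "mul A a h = scl A l h - a + scl A l p" "mul A h a = scl A l h - a + scl A l p"
  shows "D p \<in> inner_at A E a"
proof -
  define z where "z = D p"
  have z [simp]: "z \<in> vecs E" using mem by (simp add: z_def)
  note [simp] = mem
  have split: "z = z \<triangleleft> p + p \<triangleright> z" using D_mul[of p p] by (simp add: p z_def)
  have "p \<triangleright> z = p \<triangleright> (z \<triangleleft> p + p \<triangleright> z)" using split by simp
  also have "\<dots> = p \<triangleright> (z \<triangleleft> p) + p \<triangleright> z" by (simp add: act_add act_mul(1)[symmetric] p)
  finally have pzp: "(p \<triangleright> z) \<triangleleft> p = 0" by (simp add: act_mul(3))
  \<comment> \<open>This is \<open>p \<cdot> z \<cdot> (1 + h) - (1 + h) \<cdot> z\<close> with \<open>p \<cdot> z - z\<close> replaced by \<open>- z \<cdot> p\<close>.\<close>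
  define y where "y = (p \<triangleright> z) \<triangleleft> h - z \<triangleleft> p - h \<triangleright> z"
  have y: "y \<in> vecs E" by (simp add: y_def)
  have 1: "a \<triangleright> ((p \<triangleright> z) \<triangleleft> h) = scl E l ((p \<triangleright> z) \<triangleleft> h)"
    by (simp add: act_mul(3)[symmetric] act_mul(1)[symmetric] p act_scl)
  have 2: "a \<triangleright> (h \<triangleright> z) = scl E l (h \<triangleright> z) - a \<triangleright> z + scl E l (p \<triangleright> z)"
    by (simp add: act_mul(1)[symmetric] h act_add act_diff act_scl)
  have 3: "((p \<triangleright> z) \<triangleleft> h) \<triangleleft> a = scl E l ((p \<triangleright> z) \<triangleleft> h) - (p \<triangleright> z) \<triangleleft> a"
    by (simp add: act_mul(2)[symmetric] h act_add act_diff act_scl pzp)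
  have 4: "(z \<triangleleft> p) \<triangleleft> a = scl E l (z \<triangleleft> p)"
    by (simp add: act_mul(2)[symmetric] p act_scl)
  have "h \<triangleright> z = h \<triangleright> (z \<triangleleft> p + p \<triangleright> z)" using split by simp
  also have "\<dots> = (h \<triangleright> z) \<triangleleft> p - p \<triangleright> z"
    using act_diff(3)[of z 0 p] act_diff(3)[of z 0 0] by (simp add: act_add act_mul(3) act_mul(1)[symmetric] h)
  finally have 5: "(h \<triangleright> z) \<triangleleft> p = h \<triangleright> z + p \<triangleright> z" by (metis eq_diff_eq)
  have "(h \<triangleright> z + p \<triangleright> z) \<triangleleft> a = scl E l (h \<triangleright> z + p \<triangleright> z)"
    unfolding 5[symmetric] by (simp add: act_mul(2)[symmetric] p act_scl)
  then have 6: "(h \<triangleright> z) \<triangleleft> a = scl E l (h \<triangleright> z) + scl E l (p \<triangleright> z) - (p \<triangleright> z) \<triangleleft> a"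
    by (simp add: act_add E.scale_right_distrib eq_diff_eq)
  have "a \<triangleright> z = a \<triangleright> (z \<triangleleft> p + p \<triangleright> z)" using split by simp
  also have "\<dots> = a \<triangleright> (z \<triangleleft> p) + scl E l (p \<triangleright> z)"
    by (simp add: act_add act_mul(1)[symmetric] p act_scl)
  finally have 7: "a \<triangleright> (z \<triangleleft> p) = a \<triangleright> z - scl E l (p \<triangleright> z)" by simp
  have "a \<triangleright> y - y \<triangleleft> a = scl E l (z \<triangleleft> p) + scl E l (p \<triangleright> z)"
    unfolding y_def by (simp add: act_diff 1 2 3 4 6 7)
  also have "\<dots> = scl E l z" using split by (metis E.scale_right_distrib)
  finally have "scl E l z \<in> inner_at A E a" using y unfolding inner_at_def by force
  then have "scl E (1 / l) (scl E l z) \<in> inner_at A E a"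
    by (rule E.subspace_scale[OF inner_at_subspace[OF mem(1)]])
  then show ?thesis using l by (simp add: z_def)
qed

end

section \<open>Spectral idempotents in \<open>\<ell>\<^sup>1(\<nat>\<^sub>\<and>, \<omega>)\<close>\<close>

context l1_weight
begin

lemma l1_tl_diff:
  assumes a: "a \<in> vecs L" and b: "b \<in> vecs L"
  shows "tl_sum (a - b) k = tl_sum a k - tl_sum b k"
  using l1_tl_add[OF normed_space_diff[OF l1_normed a b] b, of k] by simp

lemma l1_tl_minus:
  assumes a: "a \<in> vecs L"
  shows "tl_sum (- a) k = - tl_sum a k"
  using l1_tl_scl[OF a, of "-1" k] by (simp add: fun_Compl_def)

text \<open>
  A null sequence whose increments are eventually dominated by those of the transform of some
  \<open>a\<close> is itself a transform.  In particular this applies to \<open>f (tl_sum a k)\<close> for a function \<open>f\<close>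
  that vanishes at 0 and is Lipschitz near 0.
\<close>

lemma l1_of_tl_sum:
  assumes a: "a \<in> vecs L" and u: "u \<longlonglongrightarrow> 0"
    and le: "\<forall>\<^sub>F k in sequentially. cmod (u k - u (Suc k)) \<le> C * cmod (a k)"
  shows "(\<lambda>k. u k - u (Suc k)) \<in> vecs L" and "tl_sum (\<lambda>k. u k - u (Suc k)) = u"
proof -
  have "summable (\<lambda>k. C * (cmod (a k) * \<omega> k))"
    using a by (simp add: l1_min_simps summable_mult)
  moreover have "\<forall>\<^sub>F k in sequentially. norm (cmod (u k - u (Suc k)) * \<omega> k) \<le> C * (cmod (a k) * \<omega> k)"
    using le
  proof eventually_elim
    case (elim k)
    then have "cmod (u k - u (Suc k)) * \<omega> k \<le> C * cmod (a k) * \<omega> k"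
      by (rule mult_right_mono) (rule w0)
    then show ?case using w0(2)[of k] by (simp add: mult.assoc abs_mult)
  qed
  ultimately show "(\<lambda>k. u k - u (Suc k)) \<in> vecs L"
    unfolding l1_min_simps mem_Collect_eq by (rule summable_comparison_test_ev[rotated])
  show "tl_sum (\<lambda>k. u k - u (Suc k)) = u"
  proof
    fix k
    have "(\<lambda>n. u (n + k)) \<longlonglongrightarrow> 0" using u by (rule LIMSEQ_ignore_initial_segment)
    from telescope_sums'[OF this] show "tl_sum (\<lambda>k. u k - u (Suc k)) k = u k"
      by (simp add: tl_sum_def sums_iff)
  qed
qed

definition spectral_idempotent :: "(nat \<Rightarrow> complex) \<Rightarrow> complex \<Rightarrow> nat \<Rightarrow> complex" where
  "spectral_idempotent a l = (\<lambda>k. of_bool (tl_sum a k = l) - of_bool (tl_sum a (Suc k) = l))"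

lemma spectral_idempotent:
  assumes a: "a \<in> vecs L" and l: "l \<noteq> 0"
  shows "spectral_idempotent a l \<in> vecs L"
    and "tl_sum (spectral_idempotent a l) = (\<lambda>k. of_bool (tl_sum a k = l))"
proof -
  have "\<forall>\<^sub>F k in sequentially. tl_sum a k \<noteq> l"
    by (rule tendsto_imp_eventually_ne[OF tl_sum_lim[OF l1_summable[OF a]]]) (use l in simp)
  then have ev: "\<forall>\<^sub>F k in sequentially. tl_sum a k \<noteq> l \<and> tl_sum a (Suc k) \<noteq> l"
    using eventually_sequentially_Suc[of "\<lambda>k. tl_sum a k \<noteq> l"] by (simp add: eventually_conj_iff)
  have "(\<lambda>k. of_bool (tl_sum a k = l) :: complex) \<longlonglongrightarrow> 0"
    by (rule tendsto_eventually) (use ev in \<open>auto elim: eventually_mono\<close>)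
  moreover have "\<forall>\<^sub>F k in sequentially. cmod (of_bool (tl_sum a k = l) - of_bool (tl_sum a (Suc k) = l)) \<le> 0 * cmod (a k)"
    using ev by (auto elim: eventually_mono)
  ultimately show "spectral_idempotent a l \<in> vecs L"
    "tl_sum (spectral_idempotent a l) = (\<lambda>k. of_bool (tl_sum a k = l))"
    unfolding spectral_idempotent_def by (rule l1_of_tl_sum[OF a])+
qed

text \<open>
  The transform of \<open>h\<close> is that of \<open>l (l - a)\<^sup>-\<^sup>1 - 1\<close> off the level set, and \<open>- 1\<close> on it.  It belongs
  to the algebra because \<open>z \<mapsto> z / (l - z)\<close> is Lipschitz on the disc of radius \<open>|l| / 2\<close>, which
  contains almost all values of the transform of \<open>a\<close>.
\<close>

lemma spectral_quasi_inverse: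
  assumes a: "a \<in> vecs L" and l: "l \<noteq> 0"
  obtains h where "h \<in> vecs L"
    "tl_sum h = (\<lambda>k. if tl_sum a k = l then - 1 else tl_sum a k / (l - tl_sum a k))"
proof -
  define c where "c = tl_sum a"
  define u where "u k = (if c k = l then - 1 else c k / (l - c k))" for k
  have c: "c \<longlonglongrightarrow> 0" unfolding c_def by (rule tl_sum_lim[OF l1_summable[OF a]])
  have "\<forall>\<^sub>F k in sequentially. dist (c k) 0 < cmod l / 2"
    by (rule tendstoD[OF c]) (use l in simp)
  then have small: "\<forall>\<^sub>F k in sequentially. cmod (c k) < cmod l / 2 \<and> cmod (c (Suc k)) < cmod l / 2"
    using eventually_sequentially_Suc[of "\<lambda>k. cmod (c k) < cmod l / 2"]
    by (simp add: eventually_conj_iff)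
  have far: "cmod l / 2 \<le> cmod (l - z)" if "cmod z < cmod l / 2" for z
    using norm_triangle_ineq2[of l z] that by linarith
  have "(\<lambda>k. c k / (l - c k)) \<longlonglongrightarrow> 0 / (l - 0)"
    by (intro tendsto_intros c) (use l in simp)
  then have "(\<lambda>k. c k / (l - c k)) \<longlonglongrightarrow> 0" by simp
  then have "u \<longlonglongrightarrow> 0"
    by (rule Lim_transform_eventually) (use small in \<open>auto simp: u_def elim!: eventually_mono\<close>)
  moreover have "\<forall>\<^sub>F k in sequentially. cmod (u k - u (Suc k)) \<le> 4 / cmod l * cmod (a k)"
    using small
  proof eventually_elim
    case (elim k)
    define x y where "x = l - c k" and "y = l - c (Suc k)"
    have xy: "cmod l / 2 \<le> cmod x" "cmod l / 2 \<le> cmod y" using far elim by (simp_all add: x_def y_def)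
    then have nz: "x \<noteq> 0" "y \<noteq> 0" using l by auto
    have ak: "a k = y - x"
      using tl_sum_Suc[OF l1_summable[OF a], of k] by (simp add: x_def y_def c_def)
    have "u k = (l - x) / x" "u (Suc k) = (l - y) / y" using nz by (auto simp: u_def x_def y_def)
    then have "u k - u (Suc k) = (l - x) / x - (l - y) / y" by simp
    also have "\<dots> = l * a k / (x * y)" unfolding ak using nz by (simp add: field_simps)
    finally have "u k - u (Suc k) = l * a k / (x * y)" .
    then have "cmod (u k - u (Suc k)) = cmod l * cmod (a k) / (cmod x * cmod y)"
      by (simp add: norm_divide norm_mult)
    also have "\<dots> \<le> cmod l * cmod (a k) / (cmod l / 2 * (cmod l / 2))"
      using xy l nz by (intro divide_left_mono mult_mono mult_nonneg_nonneg) auto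
    also have "\<dots> = 4 / cmod l * cmod (a k)" using l by (simp add: field_simps)
    finally show ?case .
  qed
  ultimately have h: "(\<lambda>k. u k - u (Suc k)) \<in> vecs L" "tl_sum (\<lambda>k. u k - u (Suc k)) = u"
    by (rule l1_of_tl_sum[OF a])+
  have u: "u = (\<lambda>k. if tl_sum a k = l then - 1 else tl_sum a k / (l - tl_sum a k))"
    by (simp add: u_def c_def fun_eq_iff)
  show ?thesis by (rule that[OF h(1) trans[OF h(2) u]])
qed

lemma derivation_spectral_idempotent:
  assumes D: "banach_derivation L E D" and a: "a \<in> vecs L" and l: "l \<noteq> 0"
  shows "D (spectral_idempotent a l) \<in> inner_at L E a"
proof -
  interpret banach_derivation L E D by (rule D)
  define p where "p = spectral_idempotent a l"
  have p: "p \<in> vecs L" "tl_sum p = (\<lambda>k. of_bool (tl_sum a k = l))"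
    unfolding p_def by (rule spectral_idempotent[OF a l])+
  obtain h where h: "h \<in> vecs L"
    "tl_sum h = (\<lambda>k. if tl_sum a k = l then - 1 else tl_sum a k / (l - tl_sum a k))"
    using spectral_quasi_inverse[OF a l] .
  have scl: "tl_sum (scl L l b) k = l * tl_sum b k" if "b \<in> vecs L" for b k
    using l1_tl_scl[OF that] by (simp add: l1_min_simps)
  have mul: "mul L b c \<in> vecs L" if "b \<in> vecs L" "c \<in> vecs L" for b c
    using l1_mul_bound[OF that] by simp
  have "- p = 0 - p" by simp
  then have mp: "- p \<in> vecs L" using closed(5)[OF closed(7) p(1)] by simp
  have pp: "mul L p p = p"
    by (rule l1_char_inj) (simp_all add: l1_mul_char p mul)
  have ap: "mul L a p = scl L l p"
    by (rule l1_char_inj) (simp_all add: l1_mul_char p a mul scl)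
  have hp: "mul L h p = - p"
    by (rule l1_char_inj) (simp_all add: l1_mul_char p h mul mp l1_tl_minus)
  have ah: "mul L a h = scl L l h - a + scl L l p"
    by (rule l1_char_inj)
      (simp_all add: l1_mul_char p h a mul scl l1_tl_add l1_tl_diff, simp add: field_simps)
  show ?thesis
    unfolding p_def[symmetric]
    using inner_at_idempotent[OF a p(1) h(1) l pp ap _ hp ah] ap ah
    by (simp add: l1_mul_commute a p h)
qed

text \<open>
  With \<open>r\<close> the projection onto the disc of radius \<open>e\<close>, the combination \<open>b\<close> with coefficients
  \<open>l - r l\<close> has transform \<open>c k - r (c k)\<close>, so the norm of \<open>a - b\<close> is the weighted variation of
  \<open>r (c k)\<close>.  As \<open>r\<close> is a contraction, the contribution of large \<open>k\<close> is at most a tail of the norm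
  of \<open>a\<close>; each of the finitely many remaining increments is at most \<open>2 * e\<close>.
\<close>

lemma l1_spectral_approximation:
  assumes a: "a \<in> vecs L" and d: "d > 0"
  obtains F v where "finite F" "0 \<notin> F"
    "nrm L (a - (\<Sum>l\<in>F. scl L (v l) (spectral_idempotent a l))) < d"
proof -
  define c where "c = tl_sum a"
  have c: "c \<longlonglongrightarrow> 0" unfolding c_def by (rule tl_sum_lim[OF l1_summable[OF a]])
  have ac: "a k = c k - c (Suc k)" for k
    using tl_sum_Suc[OF l1_summable[OF a], of k] by (simp add: c_def)
  have sa: "summable (\<lambda>k. cmod (a k) * \<omega> k)" using a by (simp add: l1_min_simps)
  obtain N where N: "norm (\<Sum>k. cmod (a (k + N)) * \<omega> (k + N)) < d / 2"
    using suminf_exist_split[OF _ sa, of "d / 2"] d by auto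
  define M where "M = (\<Sum>k<N. \<omega> k)"
  have M: "0 \<le> M" unfolding M_def by (intro sum_nonneg w0)
  define e where "e = d / (4 * (M + 1))"
  have e: "e > 0" "2 * e * M < d / 2" using d M by (simp_all add: e_def field_simps)
  define r where "r = closest_point (cball (0::complex) e)"
  have ne: "convex (cball (0::complex) e)" "closed (cball (0::complex) e)" "cball (0::complex) e \<noteq> {}"
    using e by auto
  have r_norm: "cmod (r z) \<le> e" for z
    using closest_point_in_set[OF ne(2,3), of z] by (simp add: r_def)
  have r_self: "r z = z" if "cmod z \<le> e" for z
    unfolding r_def by (rule closest_point_self) (use that in simp)
  have r_lip: "cmod (r z - r w) \<le> cmod (z - w)" for z w
    using closest_point_lipschitz[OF ne, of z w] by (simp add: r_def dist_norm)
  define F where "F = {l \<in> range c. e < cmod l}"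
  obtain K where K: "\<And>k. k \<ge> K \<Longrightarrow> cmod (c k) < e" using LIMSEQ_D[OF c e(1)] by auto
  have "F \<subseteq> c ` {..<K}" unfolding F_def using K by (fastforce simp: not_less[symmetric])
  then have fin: "finite F" by (rule finite_subset) simp
  define b where "b = (\<Sum>l\<in>F. scl L (l - r l) (spectral_idempotent a l))"
  have eval: "(\<Sum>l\<in>F. (l - r l) * of_bool (c k = l)) = c k - r (c k)" for k
  proof (cases "c k \<in> F")
    case True
    have "(\<Sum>l\<in>F. (l - r l) * of_bool (c k = l)) = (\<Sum>l\<in>F. if l = c k then l - r l else 0)"
      by (rule sum.cong) auto
    then show ?thesis using fin True by simp
  next
    case False
    then have "r (c k) = c k" by (intro r_self) (simp add: F_def)
    moreover have "(\<Sum>l\<in>F. (l - r l) * of_bool (c k = l)) = 0"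
      by (rule sum.neutral) (use False in auto)
    ultimately show ?thesis by simp
  qed
  have app: "(\<Sum>l\<in>G. g l) k = (\<Sum>l\<in>G. g l k)" for g :: "complex \<Rightarrow> nat \<Rightarrow> complex" and G k
    by (induction G rule: infinite_finite_induct) auto
  have b: "b k = (c k - r (c k)) - (c (Suc k) - r (c (Suc k)))" for k
    unfolding b_def app eval[symmetric] sum_subtractf[symmetric]
    by (simp add: spectral_idempotent_def l1_min_simps c_def right_diff_distrib)
  define f where "f k = cmod ((a - b) k) * \<omega> k" for k
  have ab: "(a - b) k = r (c k) - r (c (Suc k))" for k by (simp add: ac b)
  have f_le: "f k \<le> cmod (a k) * \<omega> k" "f k \<le> 2 * e * \<omega> k" for k
  proof -
    show "f k \<le> cmod (a k) * \<omega> k"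
      unfolding f_def ab ac by (rule mult_right_mono[OF r_lip w0(2)])
    have "cmod (r (c k) - r (c (Suc k))) \<le> 2 * e"
      using norm_triangle_ineq4[of "r (c k)" "r (c (Suc k))"] r_norm[of "c k"] r_norm[of "c (Suc k)"]
      by linarith
    then show "f k \<le> 2 * e * \<omega> k"
      unfolding f_def ab by (rule mult_right_mono) (rule w0)
  qed
  have f0: "0 \<le> f k" for k unfolding f_def by (intro mult_nonneg_nonneg w0) simp
  have sf: "summable f" by (rule summable_comparison_test'[OF sa]) (use f_le f0 in auto)
  have "suminf f = (\<Sum>k. f (k + N)) + (\<Sum>k<N. f k)" by (rule suminf_split_initial_segment[OF sf])
  also have "(\<Sum>k. f (k + N)) \<le> (\<Sum>k. cmod (a (k + N)) * \<omega> (k + N))"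
    using sf sa by (intro suminf_le f_le) (simp_all only: summable_iff_shift[of f] summable_iff_shift[of "\<lambda>k. cmod (a k) * \<omega> k"])
  also have "\<dots> < d / 2" using N by simp
  also have "(\<Sum>k<N. f k) \<le> 2 * e * M"
    unfolding M_def sum_distrib_left by (rule sum_mono) (rule f_le)
  also have "\<dots> < d / 2" by (rule e)
  finally have "nrm L (a - b) < d" unfolding f_def l1_min_simps by simp
  moreover have "0 \<notin> F" using e by (simp add: F_def)
  ultimately show ?thesis
    using that[OF fin, of "\<lambda>l. l - r l"] unfolding b_def by blast
qed

lemma derivation_inner_approximation:
  assumes D: "banach_derivation L E D" and a: "a \<in> vecs L" and d: "d > 0"
  shows "\<exists>y \<in> inner_at L E a. nrm E (y - D a) < d"
proof -
  interpret banach_derivation L E D by (rule D)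
  obtain K where K: "\<And>b. b \<in> vecs L \<Longrightarrow> nrm E (D b) \<le> K * nrm L b"
    using derivation by (auto simp: derivation_def bounded_linear_map_def)
  define d' where "d' = d / (\<bar>K\<bar> + 1)"
  have "d' > 0" using d by (simp add: d'_def)
  then obtain F v where F: "finite F" "0 \<notin> F"
    and lt: "nrm L (a - (\<Sum>l\<in>F. scl L (v l) (spectral_idempotent a l))) < d'"
    using l1_spectral_approximation[OF a] by blast
  define b where "b = (\<Sum>l\<in>F. scl L (v l) (spectral_idempotent a l))"
  have "b \<in> vecs L \<and> D b \<in> inner_at L E a"
    unfolding b_def using F
  proof (induction F rule: finite_induct)
    case empty
    have D0: "D 0 = 0" using linear_map_add[OF maps(5) closed(7) closed(7)] by simp
    show ?case
      unfolding sum.empty D0 using closed(7) E.subspace_0[OF inner_at_subspace[OF a]] by (rule conjI)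
  next
    case (insert l F)
    let ?p = "spectral_idempotent a l"
    have p: "?p \<in> vecs L" "D ?p \<in> inner_at L E a"
      using insert spectral_idempotent(1)[OF a] derivation_spectral_idempotent[OF D a] by auto
    have sp: "scl L (v l) ?p \<in> vecs L" using p(1) by (rule closed(6))
    have "D (scl L (v l) ?p) = scl E (v l) (D ?p)" by (rule linear_map_scl[OF maps(5) p(1)])
    then have Dp: "D (scl L (v l) ?p) \<in> inner_at L E a"
      using E.subspace_scale[OF inner_at_subspace[OF a] p(2)] by simp
    define q where "q = (\<Sum>l\<in>F. scl L (v l) (spectral_idempotent a l))"
    have q: "q \<in> vecs L" "D q \<in> inner_at L E a"
      unfolding q_def using insert by simp_all
    show ?case
      unfolding sum.insert[OF insert.hyps] q_def[symmetric] linear_map_add[OF maps(5) sp q(1)]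
      by (intro conjI closed(4)[OF sp q(1)] E.subspace_add[OF inner_at_subspace[OF a] Dp q(2)])
  qed
  then have b: "b \<in> vecs L" "D b \<in> inner_at L E a" by simp_all
  have ba: "a - b \<in> vecs L" using a b(1) by (rule closed(5))
  have "nrm E (D b - D a) = nrm E (D a - D b)"
    using Metric_space.commute[OF Metric_space_ndist[OF normed(2)], of "D a" "D b"] a b(1)
    by (simp add: ndist_def)
  also have "\<dots> = nrm E (D (a - b))"
    by (simp only: linear_map_diff[OF maps(5) normed(1) a b(1)])
  also have "\<dots> \<le> K * nrm L (a - b)" by (rule K[OF ba])
  also have "\<dots> \<le> (\<bar>K\<bar> + 1) * nrm L (a - b)"
    using normed(1) ba by (intro mult_right_mono) (auto simp: normed_space_def)
  also have "\<dots> < d" using lt unfolding b_def[symmetric] d'_def by (simp add: field_simps)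
  finally show ?thesis using b(2) by blast
qed

end

section \<open>Norm approximation and \<open>w\<^sup>*\<close>-convergent nets\<close>

lemma wstar_nhd_contains_ball:
  assumes E: "normed_space E" and P: "P \<subseteq> vecs (dual_space E)"
    and U: "openin (wstar E P) U" "z \<in> U" and z: "z \<in> vecs E"
  shows "\<exists>d>0. \<forall>x\<in>vecs E. nrm E (x - z) < d \<longrightarrow> x \<in> U"
proof -
  have "generate_topology_on {{x \<in> vecs E. f x \<in> U} |f U. f \<in> P \<and> open U} U"
    using U(1) unfolding wstar_def by (rule openin_topology_generated_by)
  then show ?thesis using U(2)
  proof induction
    case (Int U V)
    then obtain d e where "d > 0" "\<forall>x\<in>vecs E. nrm E (x - z) < d \<longrightarrow> x \<in> U"
      and "e > 0" "\<forall>x\<in>vecs E. nrm E (x - z) < e \<longrightarrow> x \<in> V" by blast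
    then show ?case by (intro exI[of _ "min d e"]) auto
  next
    case (UN K)
    then obtain k where k: "k \<in> K" "z \<in> k" by blast
    show ?case using UN.IH[OF k] k(1) by blast
  next
    case (Basis W)
    then obtain f V where f: "f \<in> P" "open V" and W: "W = {x \<in> vecs E. f x \<in> V}" by blast
    have "f z \<in> V" using Basis(2) W by blast
    then obtain r where r: "r > 0" "ball (f z) r \<subseteq> V"
      using f(2) open_contains_ball by blast
    have fd: "f \<in> vecs (dual_space E)" using f P by blast
    define K where "K = nrm (dual_space E) f"
    have K: "0 \<le> K" using dual_space_normed[OF E] fd by (simp add: normed_space_def K_def)
    have "x \<in> W" if x: "x \<in> vecs E" "nrm E (x - z) < r / (K + 1)" for x
    proof -
      have xz: "x - z \<in> vecs E" by (rule normed_space_diff[OF E x(1) z])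
      have "f ((x - z) + z) = f (x - z) + f z" using fd xz z unfolding mem_dual_space by blast
      then have "cmod (f x - f z) \<le> K * nrm E (x - z)"
        using dual_space_bound[OF E fd xz] by (simp add: K_def)
      also have "\<dots> \<le> (K + 1) * nrm E (x - z)"
        using E xz by (simp add: normed_space_def distrib_right)
      also have "\<dots> < r" using x(2) K by (simp add: field_simps)
      finally have "f x \<in> V" using r(2) by (auto simp: dist_norm norm_minus_commute)
      then show ?thesis using x(1) W by blast
    qed
    then show ?case using r K by (intro exI[of _ "r / (K + 1)"]) auto
  qed simp
qed

text \<open>
  This turns approximation within every neighbourhood into a convergent net whose indices are subsets
  of the space itself.
\<close>

lemma limitin_nhds_net:
  assumes z: "z \<in> topspace T" and x: "\<And>U. openin T U \<Longrightarrow> z \<in> U \<Longrightarrow> g U \<in> U"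
  defines "I \<equiv> {U. openin T U \<and> z \<in> U}"
  shows "directed_set I (\<supseteq>)" "limitin T g z (net_filter I (\<supseteq>))"
proof -
  have top: "topspace T \<in> I" using z by (simp add: I_def)
  have cap: "U \<inter> V \<in> I" if "U \<in> I" "V \<in> I" for U V using that by (auto simp: I_def)
  show "directed_set I (\<supseteq>)"
    unfolding directed_set_def using top cap by (fastforce intro!: bexI[of _ "_ \<inter> _"])
  show "limitin T g z (net_filter I (\<supseteq>))"
    unfolding limitin_def
  proof (intro conjI allI impI z)
    fix U assume U: "openin T U \<and> z \<in> U"
    have "net_filter I (\<supseteq>) \<le> principal {V \<in> I. V \<subseteq> U}"
      unfolding net_filter_def by (rule INF_lower) (use U in \<open>simp add: I_def\<close>)
    moreover have "eventually (\<lambda>V. g V \<in> U) (principal {V \<in> I. V \<subseteq> U})"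
      unfolding eventually_principal using x by (auto simp: I_def)
    ultimately show "eventually (\<lambda>V. g V \<in> U) (net_filter I (\<supseteq>))" by (rule filter_leD)
  qed
qed

theorem theorem3p2:
  fixes \<omega> :: "nat \<Rightarrow> real"
  assumes "\<And>n. 1 \<le> \<omega> n"
    and "filterlim \<omega> at_top sequentially"
  shows "\<not> connes_amenable TYPE(nat \<Rightarrow> complex) (l1_min \<omega>) (c0_predual \<omega>) \<and>
         \<not> pointwise_connes_amenable TYPE(nat \<Rightarrow> complex) (l1_min \<omega>) (c0_predual \<omega>) \<and>
         pointwise_wstar_approx_connes_amenable TYPE('e::ab_group_add) (l1_min \<omega>) (c0_predual \<omega>)"
proof -
  interpret l1_weight \<omega> by unfold_locales (rule assms(1))
  note dual = l1_min_dual_banach_algebra[OF assms]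
  have algebra: "banach_algebra L" using dual by (simp add: dual_banach_algebra_def)
  have not_pointwise: "\<not> pointwise_connes_amenable TYPE(nat \<Rightarrow> complex) L (c0_predual \<omega>)"
    using pointwise_connes_amenable_imp_right_identity[OF dual] l1_no_right_identity by blast
  moreover have "pointwise_connes_amenable TYPE(nat \<Rightarrow> complex) L (c0_predual \<omega>)"
    if "connes_amenable TYPE(nat \<Rightarrow> complex) L (c0_predual \<omega>)"
    using that unfolding connes_amenable_def pointwise_connes_amenable_def by meson
  moreover have "pointwise_wstar_approx_connes_amenable TYPE('e) L (c0_predual \<omega>)"
    unfolding pointwise_wstar_approx_connes_amenable_def
  proof (intro ballI allI impI)
    fix a and E :: "(nat \<Rightarrow> complex, 'e) bimodule" and PE D
    assume a: "a \<in> vecs L"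
      and "normal_dual_bimodule L (c0_predual \<omega>) E PE \<and> wstar_derivation L (c0_predual \<omega>) E PE D"
    then have E: "dual_bimodule L E PE" and D: "derivation L E D"
      by (simp_all add: normal_dual_bimodule_def wstar_derivation_def)
    then have bim: "banach_bimodule L E" and PE: "PE \<subseteq> vecs (dual_space E)"
      and "module.subspace (\<lambda>c f x. c * f x) PE"
      by (simp_all add: dual_bimodule_def dual_space_def)
    then have "PE \<noteq> {}" unfolding subspace_fun_def by blast
    then have top: "topspace (wstar E PE) = vecs E" by (rule wstar_topspace)
    interpret banach_derivation L E D by unfold_locales (fact algebra bim D)+
    have Da: "D a \<in> topspace (wstar E PE)" using a top by simp
    have "\<exists>x\<in>vecs E. lact E a x - ract E x a \<in> U" if U: "openin (wstar E PE) U" "D a \<in> U" for U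
    proof -
      obtain d where d: "d > 0" "\<And>x. x \<in> vecs E \<Longrightarrow> nrm E (x - D a) < d \<Longrightarrow> x \<in> U"
        using wstar_nhd_contains_ball[OF normed(2) PE U] a by auto
      obtain x where x: "x \<in> vecs E" "nrm E (lact E a x - ract E x a - D a) < d"
        using derivation_inner_approximation[OF banach_derivation_axioms a d(1)]
        by (auto simp: inner_at_def)
      then have "lact E a x - ract E x a \<in> U" using a by (intro d(2)) simp_all
      with x(1) show ?thesis by blast
    qed
    then obtain x where x: "x U \<in> vecs E" "lact E a (x U) - ract E (x U) a \<in> U"
      if "openin (wstar E PE) U" "D a \<in> U" for U by metis
    show "\<exists>(I :: 'e set set) le x. directed_set I le \<and> (\<forall>i\<in>I. x i \<in> vecs E) \<and>
        limitin (wstar E PE) (\<lambda>i. lact E a (x i) - ract E (x i) a) (D a) (net_filter I le)"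
    proof (intro exI conjI)
      show "\<forall>U\<in>{U. openin (wstar E PE) U \<and> D a \<in> U}. x U \<in> vecs E" using x(1) by blast
    qed (rule limitin_nhds_net[OF Da]; use x(2) in blast)+
  qed
  ultimately show ?thesis by blast
qed

end
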